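(* The density Boolean algebra $$\mathcal{D}=\Big\{A\subseteq\omega\colon\ \lim_{n\to\infty}\frac{|A\cap\{0,\ldots,n-1\}|}{n}\in\{0,1\}\Big\}$$ has the following properties: (1) its Stone space $St(\mathcal{D})$ does not have any non-trivial convergent sequences; (2) if $X\subseteq St(\mathcal{D})$ is infinite, then there exists an infinite subset $Y\subseteq X$ such that the closure $\overline{Y}^{St(\mathcal{D})}$ is homeomorphic to $\beta\omega$; (3) $St(\mathcal{D})$ has the finitely supported Josefson--Nissenzweig property; (4) every fsJN-sequence $\langle\mu_n\colon n\in\omega\rangle$ on $St(\mathcal{D})$ has the property that $\lim_{n\to\infty}|\mathrm{supp}(\mu_n)|=\infty$.
   Context: The condition in the definition of $\mathcal{D}$ means that the limit (asymptotic density of $A$) exists and equals $0$ or $1$; $\mathcal{D}$ is a Boolean algebra under the set operations of $\wp(\omega)$. $\beta\omega$ is the Čech--Stone compactification of the discrete space $\omega$. An fsJN-sequence on a compact Hausdorff space $K$ is a sequence $\langle\mu_n\colon n\in\omega\rangle$ of finitely supported signed Radon measures on $K$ with total variation norm $\|\mu_n\|=1$ for every $n$ and $\lim_n\int_K f\,d\mu_n=0$ for every $f\in C(K)$. $K$ has the finitely supported Josefson--Nissenzweig property (fsJNP) if it admits an fsJN-sequence. *)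

theory Defs
  imports "HOL-Analysis.Analysis"
begin

section \<open>The density Boolean algebra\<close>

definition density_algebra :: "nat set set" where
  "density_algebra =
     {A. \<exists>d\<in>{0, 1}. (\<lambda>n. real (card (A \<inter> {..<n})) / real n) \<longlonglongrightarrow> d}"

lemma algebra_density_algebra: "algebra UNIV density_algebra"
proof -
  let ?r = "\<lambda>A n. real (card (A \<inter> {..<n})) / real n"
  have le1: "?r A n \<le> 1" for A n
  proof -
    have "card (A \<inter> {..<n}) \<le> card {..<n}"
      by (intro card_mono) auto
    then show ?thesis
      by (cases "n = 0") auto
  qed
  have compl: "?r (UNIV - A) n = 1 - ?r A n" if "n > 0" for A n
  proof -
    have "(UNIV - A) \<inter> {..<n} = {..<n} - A \<inter> {..<n}"
      by auto
    then have "card ((UNIV - A) \<inter> {..<n}) = n - card (A \<inter> {..<n})"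
      by (simp add: card_Diff_subset)
    moreover have "card (A \<inter> {..<n}) \<le> n"
      using card_mono[of "{..<n}" "A \<inter> {..<n}"] by simp
    ultimately show ?thesis
      using that by (simp add: of_nat_diff diff_divide_distrib)
  qed
  have one: "A \<in> density_algebra" if "?r B \<longlonglongrightarrow> 1" "B \<subseteq> A" for A B
  proof -
    have "?r B n \<le> ?r A n" for n
      using that(2) by (intro divide_right_mono of_nat_mono card_mono) auto
    then have "?r A \<longlonglongrightarrow> 1"
      using le1 by (intro tendsto_sandwich[OF _ _ that(1) tendsto_const]) auto
    then show ?thesis
      by (auto simp: density_algebra_def)
  qed
  show ?thesis
    unfolding algebra_iff_Un
  proof (intro conjI ballI)
    show "{} \<in> density_algebra"
      by (auto simp: density_algebra_def)
  next
    fix A assume "A \<in> density_algebra"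
    then obtain d where d: "d = 0 \<or> d = 1" "?r A \<longlonglongrightarrow> d"
      by (auto simp: density_algebra_def)
    have "(\<lambda>n. 1 - ?r A n) \<longlonglongrightarrow> 1 - d"
      by (intro tendsto_intros d)
    moreover have "\<forall>\<^sub>F n in sequentially. 1 - ?r A n = ?r (UNIV - A) n"
      using eventually_gt_at_top[of 0] by eventually_elim (simp only: compl)
    ultimately have "?r (UNIV - A) \<longlonglongrightarrow> 1 - d"
      by (rule Lim_transform_eventually)
    then show "UNIV - A \<in> density_algebra"
      using d(1) unfolding density_algebra_def by force
  next
    fix A B assume A: "A \<in> density_algebra" and B: "B \<in> density_algebra"
    show "A \<union> B \<in> density_algebra"
    proof (cases "?r A \<longlonglongrightarrow> 1 \<or> ?r B \<longlonglongrightarrow> 1")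
      case True
      then show ?thesis
        using one[of A "A \<union> B"] one[of B "A \<union> B"] by blast
    next
      case False
      with A B have "?r A \<longlonglongrightarrow> 0" "?r B \<longlonglongrightarrow> 0"
        by (auto simp: density_algebra_def)
      then have *: "(\<lambda>n. ?r A n + ?r B n) \<longlonglongrightarrow> 0"
        using tendsto_add by fastforce
      have "?r (A \<union> B) n \<le> ?r A n + ?r B n" for n
        using card_Un_le[of "A \<inter> {..<n}" "B \<inter> {..<n}"]
        by (simp add: Int_Un_distrib2 divide_right_mono flip: add_divide_distrib of_nat_add)
      then have "?r (A \<union> B) \<longlonglongrightarrow> 0"
        by (intro tendsto_sandwich[OF _ _ tendsto_const *]) auto
      then show ?thesis
        by (auto simp: density_algebra_def)
    qed
  qed auto
qed

section \<open>Stone spaces of algebras of sets\<close>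

definition ultrafilter_in :: "'a set \<Rightarrow> 'a set set \<Rightarrow> 'a set set \<Rightarrow> bool" where
  "ultrafilter_in \<Omega> M U \<longleftrightarrow>
     U \<subseteq> M \<and> \<Omega> \<in> U \<and> {} \<notin> U \<and>
     (\<forall>A\<in>U. \<forall>B\<in>U. A \<inter> B \<in> U) \<and>
     (\<forall>A\<in>U. \<forall>B\<in>M. A \<subseteq> B \<longrightarrow> B \<in> U) \<and>
     (\<forall>A\<in>M. A \<in> U \<or> \<Omega> - A \<in> U)"

definition Stone_space :: "'a set \<Rightarrow> 'a set set \<Rightarrow> 'a set set topology" where
  "Stone_space \<Omega> M =
     topology_generated_by ((\<lambda>A. {U. ultrafilter_in \<Omega> M U \<and> A \<in> U}) ` M)"

lemma topspace_Stone_space: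
  assumes "\<Omega> \<in> M"
  shows "topspace (Stone_space \<Omega> M) = {U. ultrafilter_in \<Omega> M U}"
  using assms unfolding Stone_space_def topology_generated_by_topspace
  by (auto simp: ultrafilter_in_def)

abbreviation St_density :: "nat set set topology" where
  "St_density \<equiv> Stone_space UNIV density_algebra"

section \<open>Convergent sequences\<close>

definition nontrivial_convergent_seq :: "'a topology \<Rightarrow> (nat \<Rightarrow> 'a) \<Rightarrow> bool" where
  "nontrivial_convergent_seq X x \<longleftrightarrow>
     range x \<subseteq> topspace X \<and> (\<exists>l. limitin X x l sequentially) \<and>
     \<not> (\<exists>c. \<forall>\<^sub>F n in sequentially. x n = c)"

section \<open>The Cech--Stone compactification\<close>

text \<open>The closure, in the cube indexed by the continuous functions from \<open>X\<close> to \<open>[0,1]\<close>, of the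
  image of \<open>X\<close> under evaluation. Indices are taken extensional so that each continuous function on
  \<open>topspace X\<close> occurs exactly once.\<close>

definition unit_functions :: "'a topology \<Rightarrow> ('a \<Rightarrow> real) set" where
  "unit_functions X =
     {f \<in> extensional (topspace X). continuous_map X (top_of_set {0..1}) f}"

definition Cech_Stone :: "'a topology \<Rightarrow> (('a \<Rightarrow> real) \<Rightarrow> real) topology" where
  "Cech_Stone X =
     (let Q = product_topology (\<lambda>_. top_of_set {0..1}) (unit_functions X)
      in subtopology Q (Q closure_of ((\<lambda>x. \<lambda>f\<in>unit_functions X. f x) ` topspace X)))"

abbreviation beta_omega :: "((nat \<Rightarrow> real) \<Rightarrow> real) topology" where
  "beta_omega \<equiv> Cech_Stone (discrete_topology UNIV)"

section \<open>Signed Radon measures\<close>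

text \<open>A signed measure is a real-valued set function of which only the values on Borel sets matter.
  Variations take values in \<^typ>\<open>ennreal\<close>, so that the suprema need no boundedness proof.\<close>

definition borel_sets :: "'a topology \<Rightarrow> 'a set set" where
  "borel_sets K = sigma_sets (topspace K) {U. openin K U}"

definition signed_borel_measure :: "'a topology \<Rightarrow> ('a set \<Rightarrow> real) \<Rightarrow> bool" where
  "signed_borel_measure K \<mu> \<longleftrightarrow>
     \<mu> {} = 0 \<and>
     (\<forall>A :: nat \<Rightarrow> 'a set. range A \<subseteq> borel_sets K \<longrightarrow> disjoint_family A \<longrightarrow>
        (\<lambda>n. \<mu> (A n)) sums \<mu> (\<Union>n. A n))"

text \<open>In the supremum below, \<^const>\<open>ennreal\<close> sends negative values to \<open>0\<close>, which is attained at the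
  empty set anyway.\<close>

definition upper_variation :: "'a topology \<Rightarrow> ('a set \<Rightarrow> real) \<Rightarrow> 'a set \<Rightarrow> ennreal" where
  "upper_variation K \<mu> A = (SUP E\<in>{E \<in> borel_sets K. E \<subseteq> A}. ennreal (\<mu> E))"

definition lower_variation :: "'a topology \<Rightarrow> ('a set \<Rightarrow> real) \<Rightarrow> 'a set \<Rightarrow> ennreal" where
  "lower_variation K \<mu> A = upper_variation K (\<lambda>E. - \<mu> E) A"

definition variation :: "'a topology \<Rightarrow> ('a set \<Rightarrow> real) \<Rightarrow> 'a set \<Rightarrow> ennreal" where
  "variation K \<mu> A = upper_variation K \<mu> A + lower_variation K \<mu> A"

definition signed_radon_measure :: "'a topology \<Rightarrow> ('a set \<Rightarrow> real) \<Rightarrow> bool" where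
  "signed_radon_measure K \<mu> \<longleftrightarrow>
     signed_borel_measure K \<mu> \<and>
     (\<forall>A\<in>borel_sets K.
        variation K \<mu> A = (SUP C\<in>{C \<in> borel_sets K. compactin K C \<and> C \<subseteq> A}. variation K \<mu> C))"

definition total_variation :: "'a topology \<Rightarrow> ('a set \<Rightarrow> real) \<Rightarrow> ennreal" where
  "total_variation K \<mu> = variation K \<mu> (topspace K)"

definition supp :: "'a topology \<Rightarrow> ('a set \<Rightarrow> real) \<Rightarrow> 'a set" where
  "supp K \<mu> = {x \<in> topspace K. \<forall>U. openin K U \<longrightarrow> x \<in> U \<longrightarrow> variation K \<mu> U > 0}"

text \<open>Integration against a signed measure through its Jordan decomposition.\<close>

definition signed_integral :: "'a topology \<Rightarrow> ('a set \<Rightarrow> real) \<Rightarrow> ('a \<Rightarrow> real) \<Rightarrow> real" where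
  "signed_integral K \<mu> f =
     integral\<^sup>L (measure_of (topspace K) (borel_sets K) (upper_variation K \<mu>)) f -
     integral\<^sup>L (measure_of (topspace K) (borel_sets K) (lower_variation K \<mu>)) f"

section \<open>The finitely supported Josefson--Nissenzweig property\<close>

definition fsJN_sequence :: "'a topology \<Rightarrow> (nat \<Rightarrow> 'a set \<Rightarrow> real) \<Rightarrow> bool" where
  "fsJN_sequence K \<mu> \<longleftrightarrow>
     (\<forall>n. signed_radon_measure K (\<mu> n) \<and> finite (supp K (\<mu> n)) \<and> total_variation K (\<mu> n) = 1) \<and>
     (\<forall>f. continuous_map K euclideanreal f \<longrightarrow> (\<lambda>n. signed_integral K (\<mu> n) f) \<longlonglongrightarrow> 0)"

definition fsJNP :: "'a topology \<Rightarrow> bool" where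
  "fsJNP K \<longleftrightarrow> compact_space K \<and> Hausdorff_space K \<and> (\<exists>\<mu>. fsJN_sequence K \<mu>)"

end

theory Submission
  imports Defs
begin

text \<open>Call the ultrafilter of sets of density one the generic point. Any other ultrafilter on
the density algebra contains a set of density zero, and all subsets of such a set belong to the
algebra, so away from the generic point the Stone space is locally a Cech--Stone compactification of
a set of integers. What makes this usable globally is a diagonal argument: for each \<open>e >
0\<close>, every point except the generic one and finitely many principal ones has a member
\<open>A\<close> with at most \<open>e * n\<close> elements below \<open>n\<close> for every
\<open>n\<close> (\<open>uniformly_small_member\<close>), and countably many such members with
bounds \<open>(1/2)^i\<close> still have a union of density zero
(\<open>density_zero_Union_small\<close>).

Picking disjoint members of this kind along an infinite set of points produces a sequence for which
every set of indices is cut out by some member of the algebra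
(\<open>infinite_set_contains_independent_sequence\<close>). Bounded functions on such a sequence
extend to its closure, which identifies the closure with the Cech--Stone compactification of the
integers (\<open>Stone_closure_homeomorphic_beta_omega\<close>). This is the second claim.

The first and the fourth claim rest on one separation principle: if \<open>x n \<noteq> z n\<close>
for all \<open>n\<close>, then a single clopen set contains \<open>x n\<close> and misses \<open>z
n\<close> for infinitely many \<open>n\<close> (\<open>separate_sequences\<close>). Taking
\<open>z\<close> constant excludes convergent sequences. For the fourth claim, suppose that
infinitely many measures of an fsJN-sequence have at most \<open>m\<close> support points. Each of
them has an atom of weight at least \<open>1/m\<close>, and applying the principle \<open>m\<close>
times isolates this atom from the rest of the support, for infinitely many of the measures, by one
clopen set. The integrals of its indicator stay away from zero. That a Radon measure with finite
support is a combination of point masses, so that atoms are all there is, follows from inner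
regularity (\<open>radon_finite_supp_eq_discrete\<close>).

For the third claim, compare the uniform distribution on the first \<open>n\<close> principal
ultrafilters with the point mass at the generic point. A clopen neighbourhood of the generic point
is given by a set of density one, so the difference tends to zero on every continuous function
(\<open>continuous_map_St_density_means\<close>).\<close>

section \<open>Stone spaces of algebras of sets\<close>

context algebra
begin

lemma ultrafilter_sub: "ultrafilter_in \<Omega> M U \<Longrightarrow> A \<in> U \<Longrightarrow> A \<in> M"
  unfolding ultrafilter_in_def by blast

lemma ultrafilter_mono:
  "ultrafilter_in \<Omega> M U \<Longrightarrow> A \<in> U \<Longrightarrow> B \<in> M \<Longrightarrow> A \<subseteq> B \<Longrightarrow> B \<in> U"
  unfolding ultrafilter_in_def by blast

lemma ultrafilter_empty: "ultrafilter_in \<Omega> M U \<Longrightarrow> {} \<notin> U"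
  unfolding ultrafilter_in_def by blast

lemma ultrafilter_space: "ultrafilter_in \<Omega> M U \<Longrightarrow> \<Omega> \<in> U"
  unfolding ultrafilter_in_def by blast

lemma ultrafilter_Int_iff:
  "ultrafilter_in \<Omega> M U \<Longrightarrow> A \<in> M \<Longrightarrow> B \<in> M \<Longrightarrow> A \<inter> B \<in> U \<longleftrightarrow> A \<in> U \<and> B \<in> U"
  unfolding ultrafilter_in_def by (metis inf_le1 inf_le2)

lemma ultrafilter_compl_iff:
  assumes "ultrafilter_in \<Omega> M U" "A \<in> M"
  shows "\<Omega> - A \<in> U \<longleftrightarrow> A \<notin> U"
proof -
  have "A \<inter> (\<Omega> - A) = {}" by blast
  then show ?thesis
    using assms unfolding ultrafilter_in_def by metis
qed

lemma ultrafilter_Un_iff: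
  assumes "ultrafilter_in \<Omega> M U" "A \<in> M" "B \<in> M"
  shows "A \<union> B \<in> U \<longleftrightarrow> A \<in> U \<or> B \<in> U"
proof -
  have "\<Omega> - (A \<union> B) = (\<Omega> - A) \<inter> (\<Omega> - B)" by blast
  then show ?thesis
    using assms ultrafilter_compl_iff[of U "A \<union> B"] ultrafilter_compl_iff[of U A]
      ultrafilter_compl_iff[of U B] ultrafilter_Int_iff[of U "\<Omega> - A" "\<Omega> - B"]
    by (auto simp: Un compl_sets)
qed

lemma ultrafilter_Union_iff:
  assumes "ultrafilter_in \<Omega> M U" "finite I" "\<And>i. i \<in> I \<Longrightarrow> A i \<in> M"
  shows "(\<Union>i\<in>I. A i) \<in> U \<longleftrightarrow> (\<exists>i\<in>I. A i \<in> U)"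
  using assms(2,3)
proof (induction I rule: finite_induct)
  case empty
  then show ?case using ultrafilter_empty[OF assms(1)] by simp
next
  case (insert i I)
  then have "(\<Union>i\<in>I. A i) \<in> M" by (intro finite_UN) auto
  with insert show ?case
    using ultrafilter_Un_iff[OF assms(1), of "A i" "\<Union>i\<in>I. A i"] by auto
qed

lemma ultrafilter_neqE:
  assumes "ultrafilter_in \<Omega> M U" "ultrafilter_in \<Omega> M V" "U \<noteq> V"
  obtains A where "A \<in> M" "A \<in> U" "A \<notin> V"
proof (cases "U \<subseteq> V")
  case True
  then obtain A where "A \<in> V" "A \<notin> U" using assms(3) by blast
  then show ?thesis
    using that[of "\<Omega> - A"] assms(1,2) ultrafilter_compl_iff ultrafilter_sub compl_sets
    by metis
next
  case False
  then show ?thesis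
    using that assms(1) ultrafilter_sub by blast
qed

lemma topspace_Stone: "topspace (Stone_space \<Omega> M) = {U. ultrafilter_in \<Omega> M U}"
  by (rule topspace_Stone_space[OF top])

abbreviation Stone_set :: "'a set \<Rightarrow> 'a set set set" where
  "Stone_set A \<equiv> {U. ultrafilter_in \<Omega> M U \<and> A \<in> U}"

lemma openin_Stone_set: "A \<in> M \<Longrightarrow> openin (Stone_space \<Omega> M) (Stone_set A)"
  unfolding Stone_space_def by (rule topology_generated_by_Basis) blast

text \<open>The sets \<open>Stone_set A\<close> are only a subbase by definition. They form a base
because an ultrafilter turns finite intersections in the algebra into finite intersections of such
sets.\<close>

lemma Stone_space_base:
  assumes "openin (Stone_space \<Omega> M) W" "u \<in> W"
  shows "\<exists>A\<in>M. A \<in> u \<and> Stone_set A \<subseteq> W"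
proof -
  have u: "ultrafilter_in \<Omega> M u"
    using openin_subset[OF assms(1)] assms(2) unfolding topspace_Stone by blast
  show ?thesis
    using assms unfolding Stone_space_def openin_topology_generated_by_iff
  proof (induction W)
    case Empty
    then show ?case by simp
  next
    case (Int V W)
    then obtain A B where *: "A \<in> M" "A \<in> u" "Stone_set A \<subseteq> V" "B \<in> M" "B \<in> u" "Stone_set B \<subseteq> W"
      by auto
    have "A \<inter> B \<in> M" using * by blast
    then have "Stone_set (A \<inter> B) \<subseteq> V \<inter> W"
      using * ultrafilter_Int_iff by blast
    moreover have "A \<inter> B \<in> u" using * u ultrafilter_Int_iff by blast
    ultimately show ?case using \<open>A \<inter> B \<in> M\<close> by blast
  next
    case (UN K)
    then show ?case by blast
  next
    case (Basis s)
    then show ?case by blast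
  qed
qed

lemma Hausdorff_Stone_space: "Hausdorff_space (Stone_space \<Omega> M)"
  unfolding Hausdorff_space_def
proof (intro allI impI)
  fix U V assume "U \<in> topspace (Stone_space \<Omega> M) \<and> V \<in> topspace (Stone_space \<Omega> M) \<and> U \<noteq> V"
  then have *: "ultrafilter_in \<Omega> M U" "ultrafilter_in \<Omega> M V" "U \<noteq> V"
    by (auto simp: topspace_Stone)
  then obtain A where A: "A \<in> M" "A \<in> U" "A \<notin> V" by (rule ultrafilter_neqE)
  then show "\<exists>W W'. openin (Stone_space \<Omega> M) W \<and> openin (Stone_space \<Omega> M) W' \<and> U \<in> W \<and> V \<in> W' \<and> disjnt W W'"
    using * openin_Stone_set[of A] openin_Stone_set[of "\<Omega> - A"]
    by (intro exI[of _ "Stone_set A"] exI[of _ "Stone_set (\<Omega> - A)"])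
       (auto simp: disjnt_iff ultrafilter_compl_iff compl_sets)
qed

text \<open>Tychonoff's theorem replaces the ultrafilter lemma. Inside the product of two-point
spaces indexed by the algebra, each clause in the definition of an ultrafilter involves at most
three coordinates, so the characteristic functions of ultrafilters form a closed, hence compact set.
The Stone space is a continuous image of this set.\<close>

lemma compact_Stone_space: "compact_space (Stone_space \<Omega> M)"
proof -
  define T where "T = product_topology (\<lambda>_::'a set. discrete_topology (UNIV :: bool set)) M"
  define pos where "pos A = {h \<in> topspace T. h A}" for A
  define neg where "neg A = {h \<in> topspace T. \<not> h A}" for A
  define F where "F h = {A \<in> M. h A}" for h :: "'a set \<Rightarrow> bool"
  have proj: "continuous_map T (discrete_topology UNIV) (\<lambda>h. h A)" if "A \<in> M" for A
    unfolding T_def using that by (rule continuous_map_product_projection)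
  have op: "openin T (pos A)" if "A \<in> M" for A
    using openin_continuous_map_preimage[OF proj[OF that], of "{True}"] by (simp add: pos_def)
  have cl: "closedin T (pos A)" if "A \<in> M" for A
    using closedin_continuous_map_preimage[OF proj[OF that], of "{True}"] by (simp add: pos_def)
  have cl': "closedin T (neg A)" if "A \<in> M" for A
    using closedin_continuous_map_preimage[OF proj[OF that], of "{False}"] by (simp add: neg_def)
  define C where "C = {h \<in> topspace T. ultrafilter_in \<Omega> M (F h)}"
  define fam where "fam = {pos \<Omega>, neg {}}
      \<union> (\<lambda>(A, B). neg A \<union> neg B \<union> pos (A \<inter> B)) ` (M \<times> M)
      \<union> (\<lambda>(A, B). neg A \<union> pos B) ` {(A, B) \<in> M \<times> M. A \<subseteq> B}
      \<union> (\<lambda>A. pos A \<union> pos (\<Omega> - A)) ` M"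
  have "closedin T (\<Inter>fam)"
    by (rule closedin_Inter) (auto simp: fam_def compl_sets intro!: closedin_Un cl cl')
  moreover have "C = \<Inter>fam"
  proof (intro equalityI subsetI)
    fix h assume "h \<in> C"
    then have "h \<in> topspace T" "ultrafilter_in \<Omega> M (F h)" by (auto simp: C_def)
    then show "h \<in> \<Inter>fam"
      unfolding ultrafilter_in_def fam_def pos_def neg_def F_def by auto
  next
    fix h assume h: "h \<in> \<Inter>fam"
    have "h \<in> pos \<Omega>" "h \<in> neg {}" using h unfolding fam_def by auto
    moreover have "h \<in> neg A \<union> neg B \<union> pos (A \<inter> B)" if "A \<in> M" "B \<in> M" for A B
    proof -
      have "neg A \<union> neg B \<union> pos (A \<inter> B) \<in> fam" using that unfolding fam_def by auto
      with h show ?thesis by blast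
    qed
    moreover have "h \<in> neg A \<union> pos B" if "A \<in> M" "B \<in> M" "A \<subseteq> B" for A B
    proof -
      have "neg A \<union> pos B \<in> fam" using that unfolding fam_def by auto
      with h show ?thesis by blast
    qed
    moreover have "h \<in> pos A \<union> pos (\<Omega> - A)" if "A \<in> M" for A
    proof -
      have "pos A \<union> pos (\<Omega> - A) \<in> fam" using that unfolding fam_def by auto
      with h show ?thesis by blast
    qed
    ultimately show "h \<in> C"
      unfolding C_def ultrafilter_in_def F_def pos_def neg_def
      by (auto simp: compl_sets)
  qed
  moreover have "compact_space T"
    unfolding T_def by (simp add: compact_space_product_topology compact_space_discrete_topology)
  ultimately have "compactin T C" by (simp add: closedin_compact_space)
  then have cpt: "compact_space (subtopology T C)" by (simp add: compact_space_subtopology)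
  have CT: "topspace (subtopology T C) = C" by (auto simp: C_def)
  have cont: "continuous_map (subtopology T C) (Stone_space \<Omega> M) F"
    unfolding Stone_space_def
  proof (rule continuous_on_generated_topo)
    fix V assume "V \<in> Stone_set ` M"
    then obtain A where A: "A \<in> M" "V = Stone_set A" by blast
    then have "F -` V \<inter> topspace (subtopology T C) = pos A \<inter> C"
      unfolding CT by (auto simp: C_def pos_def F_def)
    then show "openin (subtopology T C) (F -` V \<inter> topspace (subtopology T C))"
      using op[OF A(1)] by (auto simp: openin_subtopology)
  next
    show "F ` topspace (subtopology T C) \<subseteq> \<Union> (Stone_set ` M)"
      unfolding CT using top ultrafilter_space by (auto simp: C_def)
  qed
  have "F ` C = topspace (Stone_space \<Omega> M)"
  proof
    show "F ` C \<subseteq> topspace (Stone_space \<Omega> M)" by (auto simp: C_def topspace_Stone)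
  next
    show "topspace (Stone_space \<Omega> M) \<subseteq> F ` C"
    proof
      fix U assume "U \<in> topspace (Stone_space \<Omega> M)"
      then have U: "ultrafilter_in \<Omega> M U" by (simp add: topspace_Stone)
      have "F (\<lambda>A\<in>M. A \<in> U) = U"
        using U ultrafilter_sub by (auto simp: F_def)
      moreover have "(\<lambda>A\<in>M. A \<in> U) \<in> topspace T" by (simp add: T_def)
      ultimately show "U \<in> F ` C" using U unfolding C_def image_iff by (metis (mono_tags, lifting) mem_Collect_eq)
    qed
  qed
  then show ?thesis
    using image_compactin[OF _ cont, of "topspace (subtopology T C)"] cpt CT
    by (simp add: compact_space_def)
qed

lemma continuous_map_Stone_indicator:
  assumes "A \<in> M"
  shows "continuous_map (Stone_space \<Omega> M) euclideanreal (\<lambda>U. of_bool (A \<in> U))"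
  unfolding continuous_map_def
proof (intro conjI allI impI)
  fix V :: "real set"
  have pos: "{U \<in> topspace (Stone_space \<Omega> M). A \<in> U} = Stone_set A"
    and neg: "{U \<in> topspace (Stone_space \<Omega> M). A \<notin> U} = Stone_set (\<Omega> - A)"
    using assms by (auto simp: topspace_Stone ultrafilter_compl_iff)
  have "openin (Stone_space \<Omega> M)
     ((if 1 \<in> V then Stone_set A else {}) \<union> (if 0 \<in> V then Stone_set (\<Omega> - A) else {}))"
    using assms openin_Stone_set compl_sets by (intro openin_Un) auto
  also have "(if 1 \<in> V then Stone_set A else {}) \<union> (if 0 \<in> V then Stone_set (\<Omega> - A) else {}) =
     {U \<in> topspace (Stone_space \<Omega> M). of_bool (A \<in> U) \<in> V}"
    unfolding pos[symmetric] neg[symmetric] by auto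
  finally show "openin (Stone_space \<Omega> M) {U \<in> topspace (Stone_space \<Omega> M). of_bool (A \<in> U) \<in> V}" .
qed auto

section \<open>Closures of independent sequences\<close>

text \<open>A sequence of ultrafilters is called independent below if the algebra cuts out every
subset of its index set. Every function into the unit interval then extends: each binary digit of
\<open>f\<close> takes two values, so it is cut out by a member of the algebra and extends to the
indicator of a clopen set, and the binary series of these indicators converges uniformly. The value
\<open>1\<close> has no binary expansion with integer part \<open>0\<close>, whence the separate
summand \<open>e0\<close>.\<close>

lemma Stone_extend_function:
  fixes y :: "nat \<Rightarrow> 'a set set" and f :: "nat \<Rightarrow> real"
  assumes y: "\<And>n. ultrafilter_in \<Omega> M (y n)"
    and indep: "\<And>S. \<exists>A\<in>M. \<forall>n. A \<in> y n \<longleftrightarrow> n \<in> S"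
    and f: "\<And>n. f n \<in> {0..1}"
  shows "\<exists>g. continuous_map (Stone_space \<Omega> M) euclideanreal g \<and> (\<forall>n. g (y n) = f n)"
proof -
  obtain A where A: "\<And>S. A S \<in> M" "\<And>S n. A S \<in> y n \<longleftrightarrow> n \<in> S"
    using indep by metis
  define e where "e k u = of_bool (A {n. odd \<lfloor>2 ^ Suc k * f n\<rfloor>} \<in> u) / (2 :: real) ^ Suc k" for k u
  define e0 where "e0 u = (of_bool (A {n. f n = 1} \<in> u) :: real)" for u
  define p where "p m u = e0 u + (\<Sum>k<m. e k u)" for m u
  define g where "g u = e0 u + (\<Sum>k. e k u)" for u
  have cont: "continuous_map (Stone_space \<Omega> M) euclideanreal (p m)" for m
    unfolding p_def e0_def e_def
    by (intro continuous_map_add continuous_map_sum continuous_map_real_divide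
        continuous_map_Stone_indicator A) auto
  have unif: "uniform_limit UNIV (\<lambda>m u. \<Sum>k<m. e k u) (\<lambda>u. \<Sum>k. e k u) sequentially"
  proof (rule Weierstrass_m_test)
    show "norm (e k u) \<le> (1 / 2) ^ Suc k" for k u
      by (auto simp: e_def of_bool_def power_one_over)
    show "summable (\<lambda>k. (1 / 2 :: real) ^ Suc k)"
      by (subst summable_Suc_iff) (simp add: summable_geometric)
  qed
  have "continuous_map (Stone_space \<Omega> M) Met_TC.mtopology g"
  proof (rule Met_TC.continuous_map_uniform_limit)
    show "\<forall>\<^sub>F m in sequentially. continuous_map (Stone_space \<Omega> M) Met_TC.mtopology (p m)"
      using cont by simp
    fix \<epsilon> :: real assume "0 < \<epsilon>"
    from uniform_limitD[OF unif this]
    show "\<forall>\<^sub>F m in sequentially. \<forall>u\<in>topspace (Stone_space \<Omega> M). g u \<in> UNIV \<and> dist (p m u) (g u) < \<epsilon>"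
      by eventually_elim (auto simp: p_def g_def dist_real_def)
  qed auto
  then have "continuous_map (Stone_space \<Omega> M) euclideanreal g" by simp
  moreover have "g (y n) = f n" for n
  proof -
    \<comment> \<open>The partial sums truncate the binary expansion of the value.\<close>
    have p: "p m (y n) = \<lfloor>2 ^ m * f n\<rfloor> / 2 ^ m" for m
    proof (induction m)
      case 0
      have "f n = 1 \<or> \<lfloor>f n\<rfloor> = 0" using f[of n] by (auto simp: floor_eq_iff)
      then show ?case by (auto simp: p_def e0_def A(2))
    next
      case (Suc m)
      define x where "x = 2 ^ m * f n"
      have "\<lfloor>2 * x\<rfloor> = 2 * \<lfloor>x\<rfloor> + of_bool (odd \<lfloor>2 * x\<rfloor>)"
      proof -
        have "\<lfloor>2 * x\<rfloor> = 2 * \<lfloor>x\<rfloor> \<or> \<lfloor>2 * x\<rfloor> = 2 * \<lfloor>x\<rfloor> + 1" by linarith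
        then show ?thesis by auto
      qed
      then have *: "real_of_int \<lfloor>2 * x\<rfloor> = 2 * \<lfloor>x\<rfloor> + of_bool (odd \<lfloor>2 * x\<rfloor>)"
        by (metis of_int_add of_int_mult of_int_numeral of_int_of_bool)
      have "p (Suc m) (y n) = \<lfloor>x\<rfloor> / 2 ^ m + of_bool (odd \<lfloor>2 * x\<rfloor>) / 2 ^ Suc m"
        using Suc by (simp add: p_def e_def A(2) x_def mult.assoc)
      also have "\<dots> = (2 * \<lfloor>x\<rfloor> + of_bool (odd \<lfloor>2 * x\<rfloor>)) / 2 ^ Suc m"
        by (simp add: add_divide_distrib)
      also have "\<dots> = \<lfloor>2 * x\<rfloor> / 2 ^ Suc m" using * by presburger
      finally show ?case by (simp add: x_def mult.assoc)
    qed
    have "(\<lambda>m. p m (y n)) \<longlonglongrightarrow> g (y n)"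
      unfolding p_def g_def using tendsto_uniform_limitI[OF unif, of "y n"]
      by (intro tendsto_add tendsto_const) auto
    moreover have "(\<lambda>m. p m (y n)) \<longlonglongrightarrow> f n"
    proof (rule LIMSEQ_I)
      fix r :: real assume "r > 0"
      obtain N where N: "(1 / 2) ^ N < r" using real_arch_pow_inv[OF \<open>r > 0\<close>, of "1/2"] by auto
      have "norm (p m (y n) - f n) < r" if "m \<ge> N" for m
      proof -
        have "(2::real) ^ m > 0" by simp
        have "\<bar>real_of_int \<lfloor>2 ^ m * f n\<rfloor> - 2 ^ m * f n\<bar> \<le> 1" by linarith
        then have "\<bar>real_of_int \<lfloor>2 ^ m * f n\<rfloor> - 2 ^ m * f n\<bar> / 2 ^ m \<le> 1 / 2 ^ m"
          by (intro divide_right_mono) auto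
        moreover have "p m (y n) - f n = (real_of_int \<lfloor>2 ^ m * f n\<rfloor> - 2 ^ m * f n) / 2 ^ m"
          by (simp add: p diff_divide_distrib)
        moreover have "1 / (2::real) ^ m \<le> (1 / 2) ^ N"
          using power_decreasing[OF that, of "1/2::real"] by (simp add: power_one_over)
        ultimately show ?thesis using N by (simp add: abs_divide)
      qed
      then show "\<exists>N. \<forall>m\<ge>N. norm (p m (y n) - f n) < r" by blast
    qed
    ultimately show ?thesis by (rule LIMSEQ_unique)
  qed
  ultimately show ?thesis by blast
qed

lemma unit_functions_discrete_nat:
  "unit_functions (discrete_topology (UNIV :: nat set)) = {f. range f \<subseteq> {0..1}}"
  by (auto simp: unit_functions_def extensional_def)

text \<open>Evaluating the extensions of all functions from the naturals to the unit interval maps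
the closure of the sequence continuously into the cube that defines the Cech--Stone
compactification. The image is the closure of the embedded naturals by compactness. The map is
injective because a member of the algebra that distinguishes two points induces a two-valued
function on the sequence, whose extension must be the indicator of that member on the whole
closure.\<close>

lemma Stone_closure_homeomorphic_beta_omega:
  fixes y :: "nat \<Rightarrow> 'a set set"
  assumes y: "\<And>n. ultrafilter_in \<Omega> M (y n)"
    and indep: "\<And>S. \<exists>A\<in>M. \<forall>n. A \<in> y n \<longleftrightarrow> n \<in> S"
  shows "subtopology (Stone_space \<Omega> M) (Stone_space \<Omega> M closure_of range y) homeomorphic_space beta_omega"
proof -
  let ?K = "Stone_space \<Omega> M"
  define cl where "cl = ?K closure_of range y"
  define UF where "UF = unit_functions (discrete_topology (UNIV :: nat set))"
  have UF: "f \<in> UF \<longleftrightarrow> range f \<subseteq> {0..1}" for f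
    by (simp add: UF_def unit_functions_discrete_nat)
  define Q where "Q = product_topology (\<lambda>_ :: nat \<Rightarrow> real. top_of_set {0..1::real}) UF"
  define E where "E = (\<lambda>n. \<lambda>f\<in>UF. (f n :: real))"
  have beta: "beta_omega = subtopology Q (Q closure_of range E)"
    by (simp add: Cech_Stone_def Let_def Q_def E_def UF_def)
  have "\<exists>g. continuous_map ?K euclideanreal g \<and> (\<forall>n. g (y n) = f n)" if "f \<in> UF" for f
    using that using that[unfolded UF] by (intro Stone_extend_function assms) blast
  then obtain g where g: "\<And>f. f \<in> UF \<Longrightarrow> continuous_map ?K euclideanreal (g f)"
      "\<And>f n. f \<in> UF \<Longrightarrow> g f (y n) = f n"
    by metis
  define G where "G u = (\<lambda>f\<in>UF. g f u)" for u
  have yK: "range y \<subseteq> topspace ?K" using y by (auto simp: topspace_Stone)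
  have ycl: "range y \<subseteq> cl" unfolding cl_def by (rule closure_of_subset[OF yK])
  have clK: "cl \<subseteq> topspace ?K" unfolding cl_def by (rule closure_of_subset_topspace)
  have top_cl: "topspace (subtopology ?K cl) = cl" using clK by auto
  have unit: "g f u \<in> {0..1}" if "f \<in> UF" "u \<in> cl" for f u
  proof -
    have "cl \<subseteq> {u \<in> topspace ?K. g f u \<in> {0..1}}"
      unfolding cl_def
    proof (rule closure_of_minimal)
      show "closedin ?K {u \<in> topspace ?K. g f u \<in> {0..1}}"
        by (rule closedin_continuous_map_preimage[OF g(1)[OF that(1)]]) simp
      show "range y \<subseteq> {u \<in> topspace ?K. g f u \<in> {0..1}}"
      proof (rule subsetI)
        fix u assume "u \<in> range y"
        then obtain n where "u = y n" by blast
        moreover have "f n \<in> {0..1}" using that(1)[unfolded UF] by blast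
        ultimately show "u \<in> {u \<in> topspace ?K. g f u \<in> {0..1}}"
          using yK g(2)[OF that(1), of n] by auto
      qed
    qed
    then show ?thesis using that(2) by blast
  qed
  have contQ: "continuous_map (subtopology ?K cl) Q G"
    unfolding Q_def continuous_map_componentwise
  proof (rule conjI)
    show "G ` topspace (subtopology ?K cl) \<subseteq> extensional UF" by (auto simp: G_def)
    show "\<forall>f\<in>UF. continuous_map (subtopology ?K cl) (top_of_set {0..1}) (\<lambda>u. G u f)"
    proof
      fix f assume f: "f \<in> UF"
      have "continuous_map (subtopology ?K cl) (top_of_set {0..1}) (g f)"
        unfolding continuous_map_in_subtopology top_cl
        using continuous_map_from_subtopology[OF g(1)[OF f]] unit[OF f] by blast
      then show "continuous_map (subtopology ?K cl) (top_of_set {0..1}) (\<lambda>u. G u f)"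
        using f by (simp add: G_def)
    qed
  qed
  have GE: "G ` range y = range E"
    unfolding image_image by (intro image_cong refl) (auto simp: G_def E_def g(2) fun_eq_iff)
  have "compact_space ?K" by (rule compact_Stone_space)
  then have "compactin ?K cl" by (simp add: cl_def closedin_compact_space)
  then have cpt: "compact_space (subtopology ?K cl)" by (simp add: compact_space_subtopology)
  have HQ: "Hausdorff_space Q"
    unfolding Q_def Hausdorff_space_product_topology
    by (simp add: Hausdorff_space_subtopology)
  have im: "G ` cl = Q closure_of range E"
  proof
    have "compactin Q (G ` cl)"
      using image_compactin[OF _ contQ, of cl] cpt unfolding compact_space_def top_cl by blast
    then have "closedin Q (G ` cl)" using HQ compactin_imp_closedin by blast
    moreover have "range E \<subseteq> G ` cl" using GE ycl by blast
    ultimately show "Q closure_of range E \<subseteq> G ` cl" by (simp add: closure_of_minimal)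
    have "subtopology ?K cl closure_of range y = cl"
      unfolding closure_of_subtopology Int_absorb1[OF ycl] cl_def[symmetric] by (rule Int_absorb)
    then show "G ` cl \<subseteq> Q closure_of range E"
      using continuous_map_image_closure_subset[OF contQ, of "range y"] GE by simp
  qed
  have inj: "inj_on G cl"
  proof (rule inj_onI, rule ccontr)
    fix u v assume uv: "u \<in> cl" "v \<in> cl" "G u = G v" "u \<noteq> v"
    then have "ultrafilter_in \<Omega> M u" "ultrafilter_in \<Omega> M v" using clK by (auto simp: topspace_Stone)
    then obtain A where A: "A \<in> M" "A \<in> u" "A \<notin> v" using uv(4) by (rule ultrafilter_neqE)
    define f where "f n = (of_bool (A \<in> y n) :: real)" for n
    have f: "f \<in> UF" by (auto simp: UF f_def)
    have "g f w = of_bool (A \<in> w)" if "w \<in> cl" for w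
      by (rule forall_in_closure_of_eq[OF that[unfolded cl_def] _ g(1)[OF f]
            continuous_map_Stone_indicator[OF A(1)]])
         (use g(2)[OF f] in \<open>auto simp: f_def\<close>)
    then have "g f u \<noteq> g f v" using uv A by simp
    moreover have "g f u = g f v" using fun_cong[OF uv(3), of f] f by (simp add: G_def)
    ultimately show False by blast
  qed
  have "continuous_map (subtopology ?K cl) beta_omega G"
    unfolding beta continuous_map_in_subtopology using contQ im top_cl by auto
  moreover have "topspace beta_omega = Q closure_of range E"
    unfolding beta topspace_subtopology by (rule Int_absorb1[OF closure_of_subset_topspace])
  moreover have "Hausdorff_space beta_omega"
    unfolding beta by (rule Hausdorff_space_subtopology[OF HQ])
  ultimately have "homeomorphic_map (subtopology ?K cl) beta_omega G"
    using cpt im inj by (intro continuous_imp_homeomorphic_map) (simp_all only: top_cl)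
  then show ?thesis
    unfolding cl_def by (rule homeomorphic_map_imp_homeomorphic_space)
qed

end

section \<open>Density zero sets and ultrafilters on the density algebra\<close>

interpretation density: algebra UNIV density_algebra
  by (rule algebra_density_algebra)

abbreviation density_ultrafilter :: "nat set set \<Rightarrow> bool" where
  "density_ultrafilter \<equiv> ultrafilter_in UNIV density_algebra"

definition freq :: "nat set \<Rightarrow> nat \<Rightarrow> real" where
  "freq A n = real (card (A \<inter> {..<n})) / real n"

definition density_zero :: "nat set \<Rightarrow> bool" where
  "density_zero A \<longleftrightarrow> freq A \<longlonglongrightarrow> 0"

lemma freq_nonneg: "0 \<le> freq A n"
  by (simp add: freq_def)

lemma freq_mono: "A \<subseteq> B \<Longrightarrow> freq A n \<le> freq B n"
  unfolding freq_def by (intro divide_right_mono of_nat_mono card_mono) auto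

lemma freq_Compl:
  assumes "n > 0"
  shows "freq (- A) n = 1 - freq A n"
proof -
  have "card (A \<inter> {..<n}) + card (- A \<inter> {..<n}) = card {..<n}"
    by (subst card_Un_disjoint[symmetric]) (auto simp flip: Int_Un_distrib2)
  then have "real (card (A \<inter> {..<n})) + real (card (- A \<inter> {..<n})) = real n"
    by (metis card_lessThan of_nat_add)
  then show ?thesis
    using assms by (simp add: freq_def field_simps)
qed

lemma density_zeroI:
  assumes "\<And>n. freq A n \<le> g n" "g \<longlonglongrightarrow> 0"
  shows "density_zero A"
  unfolding density_zero_def
  by (rule tendsto_sandwich[OF _ _ tendsto_const assms(2)]) (use freq_nonneg assms(1) in auto)

lemma density_zero_subset:
  assumes "density_zero B" "A \<subseteq> B"
  shows "density_zero A"
  using freq_mono[OF assms(2)] assms(1)[unfolded density_zero_def] by (rule density_zeroI)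

lemma freq_Compl_tendsto: "freq (- A) \<longlonglongrightarrow> 1 - d \<longleftrightarrow> freq A \<longlonglongrightarrow> d"
proof -
  have *: "freq (- A) \<longlonglongrightarrow> 1 - d" if "freq A \<longlonglongrightarrow> d" for A d
  proof -
    have "(\<lambda>n. 1 - freq A n) \<longlonglongrightarrow> 1 - d" by (intro tendsto_intros that)
    moreover have "\<forall>\<^sub>F n in sequentially. 1 - freq A n = freq (- A) n"
      using eventually_gt_at_top[of 0] by eventually_elim (simp add: freq_Compl)
    ultimately show ?thesis by (rule Lim_transform_eventually)
  qed
  show ?thesis using *[of A d] *[of "- A" "1 - d"] by auto
qed

lemma density_algebra_iff: "A \<in> density_algebra \<longleftrightarrow> density_zero A \<or> density_zero (- A)"
  using freq_Compl_tendsto[of A 1]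
  by (auto simp: density_algebra_def density_zero_def freq_def[abs_def])

lemma density_zero_finite:
  assumes "finite A"
  shows "density_zero A"
proof -
  have "(\<lambda>n. real (card A) / real n) \<longlonglongrightarrow> 0" by (rule lim_const_over_n)
  moreover have "freq A n \<le> real (card A) / real n" for n
    unfolding freq_def using assms by (intro divide_right_mono of_nat_mono card_mono) auto
  ultimately show ?thesis
    by (intro density_zeroI)
qed

lemma density_zero_Un:
  assumes "density_zero A" "density_zero B"
  shows "density_zero (A \<union> B)"
proof -
  have "freq (A \<union> B) n \<le> freq A n + freq B n" for n
    using card_Un_le[of "A \<inter> {..<n}" "B \<inter> {..<n}"]
    by (simp add: freq_def Int_Un_distrib2 divide_right_mono flip: add_divide_distrib of_nat_add)
  moreover have "(\<lambda>n. freq A n + freq B n) \<longlonglongrightarrow> 0"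
    using tendsto_add[OF assms[unfolded density_zero_def]] by simp
  ultimately show ?thesis
    by (intro density_zeroI)
qed

lemma not_density_zero_UNIV: "\<not> density_zero UNIV"
proof
  assume "density_zero UNIV"
  then have "freq UNIV \<longlonglongrightarrow> 0" by (simp add: density_zero_def)
  moreover have "freq UNIV \<longlonglongrightarrow> 1"
    using freq_Compl_tendsto[of UNIV 1] density_zero_finite[of "{}"] by (simp add: density_zero_def)
  ultimately show False using LIMSEQ_unique by fastforce
qed

lemma density_ultrafilter_Compl_iff:
  "density_ultrafilter u \<Longrightarrow> A \<in> density_algebra \<Longrightarrow> - A \<in> u \<longleftrightarrow> A \<notin> u"
  using density.ultrafilter_compl_iff by (simp add: Compl_eq_Diff_UNIV)

lemma density_algebra_Compl: "A \<in> density_algebra \<Longrightarrow> - A \<in> density_algebra"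
  by (auto simp: density_algebra_iff)

text \<open>Sets with a complement of density zero lie in the density algebra automatically. This
ultrafilter is the only one without a member of density zero, hence the only point near which not
all sets of integers are at hand to separate points.\<close>

definition density_one_point :: "nat set set" where
  "density_one_point = {A. density_zero (- A)}"

lemma density_ultrafilter_density_one_point: "density_ultrafilter density_one_point"
  unfolding ultrafilter_in_def Compl_eq_Diff_UNIV[symmetric]
proof (intro conjI ballI impI)
  show "density_one_point \<subseteq> density_algebra"
    by (auto simp: density_one_point_def density_algebra_iff)
  show "UNIV \<in> density_one_point" "{} \<notin> density_one_point"
    using not_density_zero_UNIV by (simp_all add: density_one_point_def density_zero_finite)
  fix A assume "A \<in> density_algebra"
  then show "A \<in> density_one_point \<or> - A \<in> density_one_point"
    by (auto simp: density_one_point_def density_algebra_iff)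
next
  fix A B assume "A \<in> density_one_point" "B \<in> density_one_point"
  then show "A \<inter> B \<in> density_one_point"
    using density_zero_Un[of "- A" "- B"] by (simp add: density_one_point_def)
next
  fix A B assume "A \<in> density_one_point" "A \<subseteq> B"
  then show "B \<in> density_one_point"
    using density_zero_subset[of "- A" "- B"] by (simp add: density_one_point_def)
qed

lemma density_zero_member:
  assumes "density_ultrafilter u" "u \<noteq> density_one_point"
  shows "\<exists>A\<in>u. density_zero A"
proof (rule ccontr)
  assume *: "\<not> ?thesis"
  have "A \<in> u \<longleftrightarrow> density_zero (- A)" for A
  proof
    assume "A \<in> u"
    then show "density_zero (- A)"
      using * density.ultrafilter_sub[OF assms(1)] unfolding density_algebra_iff by blast
  next
    assume A: "density_zero (- A)"
    then have "A \<in> density_algebra" "- A \<notin> u" using * by (auto simp: density_algebra_iff)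
    then show "A \<in> u" using density_ultrafilter_Compl_iff[OF assms(1)] by blast
  qed
  then have "u = density_one_point" by (auto simp: density_one_point_def)
  with assms(2) show False ..
qed

definition principal :: "nat \<Rightarrow> nat set set" where
  "principal k = {A \<in> density_algebra. k \<in> A}"

lemma density_ultrafilter_principal: "density_ultrafilter (principal k)"
  unfolding ultrafilter_in_def principal_def
  using density.Int density.compl_sets density.top by auto

lemma singleton_mem_imp_principal:
  assumes "density_ultrafilter u" "{k} \<in> u"
  shows "u = principal k"
proof -
  have "{k} \<in> density_algebra" by (simp add: density_algebra_iff density_zero_finite)
  have "A \<in> u \<longleftrightarrow> k \<in> A" if A: "A \<in> density_algebra" for A
  proof
    assume "A \<in> u"
    then have "{k} \<inter> A \<in> u"
      using assms A density.ultrafilter_Int_iff \<open>{k} \<in> density_algebra\<close> by blast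
    then show "k \<in> A" using density.ultrafilter_empty[OF assms(1)] by (cases "k \<in> A") auto
  next
    assume "k \<in> A"
    then show "A \<in> u" using density.ultrafilter_mono[OF assms A] by blast
  qed
  then show ?thesis
    using density.ultrafilter_sub[OF assms(1)] by (auto simp: principal_def)
qed

lemma lessThan_mem_imp_principal:
  assumes "density_ultrafilter u" "{..<m} \<in> u"
  shows "\<exists>k<m. {k} \<in> u"
proof -
  have "{..<m} = (\<Union>k\<in>{..<m}. {k})" by auto
  then show ?thesis
    using assms density.ultrafilter_Union_iff[OF assms(1), of "{..<m}" "\<lambda>k. {k}"]
    by (auto simp: density_algebra_iff density_zero_finite)
qed

text \<open>Principal ultrafilters at small integers are the obstruction to finding uniformly small
members. Each initial segment accounts for only finitely many of them, so every infinite set of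
points has members that avoid it.\<close>

lemma finite_ultrafilters_lessThan: "finite {u. density_ultrafilter u \<and> {..<m} \<in> u}"
proof (rule finite_subset)
  show "{u. density_ultrafilter u \<and> {..<m} \<in> u} \<subseteq> principal ` {..<m}"
    using lessThan_mem_imp_principal singleton_mem_imp_principal by blast
qed simp

section \<open>Uniformly small sets and independent sequences\<close>

text \<open>The bound is required for every \<open>n\<close>, not just eventually. This is what
makes countable unions controllable.\<close>

definition uniformly_small :: "real \<Rightarrow> nat set \<Rightarrow> bool" where
  "uniformly_small e A \<longleftrightarrow> density_zero A \<and> (\<forall>n. real (card (A \<inter> {..<n})) \<le> e * real n)"

lemma uniformly_small_subset:
  assumes "uniformly_small e B" "A \<subseteq> B"
  shows "uniformly_small e A"
proof -
  have "real (card (A \<inter> {..<n})) \<le> real (card (B \<inter> {..<n}))" for n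
    using assms(2) by (intro of_nat_mono card_mono) auto
  then show ?thesis
    using assms density_zero_subset unfolding uniformly_small_def by (meson order_trans)
qed

lemma uniformly_small_in_algebra: "uniformly_small e A \<Longrightarrow> A \<in> density_algebra"
  by (simp add: uniformly_small_def density_algebra_iff)

text \<open>A density zero member \<open>B\<close> obeys the bound from some \<open>N\<close> on.
Either the initial segment below \<open>N\<close> can be removed from \<open>B\<close> within the
ultrafilter, or the ultrafilter is principal at some \<open>k\<close>, and then \<open>k \<ge>
m\<close> makes the singleton small enough.\<close>

lemma uniformly_small_member:
  assumes u: "density_ultrafilter u" "u \<noteq> density_one_point"
    and m: "{..<m} \<notin> u" "1 \<le> e * real m"
  shows "\<exists>A\<in>u. uniformly_small e A"
proof -
  have "e > 0" using m(2) by (metis linorder_not_less mult_nonpos_nonneg not_one_le_zero of_nat_0_le_iff order_trans)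
  obtain B where B: "B \<in> u" "density_zero B" using density_zero_member[OF u] by blast
  have "\<forall>\<^sub>F n in sequentially. freq B n < e"
    using B(2) \<open>e > 0\<close> unfolding density_zero_def by (simp add: order_tendstoD)
  then obtain N where N: "\<And>n. n \<ge> N \<Longrightarrow> freq B n < e" by (auto simp: eventually_sequentially)
  show ?thesis
  proof (cases "{..<N} \<in> u")
    case False
    have lt: "{..<N} \<in> density_algebra" by (simp add: density_algebra_iff density_zero_finite)
    have BD: "B \<in> density_algebra" using B(2) by (simp add: density_algebra_iff)
    have "B \<inter> - {..<N} \<in> u"
      using False B(1) BD lt density_algebra_Compl
        density.ultrafilter_Int_iff[OF u(1) BD density_algebra_Compl[OF lt]]
        density_ultrafilter_Compl_iff[OF u(1) lt] by blast
    moreover have "uniformly_small e (B \<inter> - {..<N})"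
      unfolding uniformly_small_def
    proof (intro conjI allI)
      show "density_zero (B \<inter> - {..<N})" using B(2) by (rule density_zero_subset) blast
      fix n
      show "real (card (B \<inter> - {..<N} \<inter> {..<n})) \<le> e * real n"
      proof (cases "n \<le> N")
        case True
        then have "B \<inter> - {..<N} \<inter> {..<n} = {}" by auto
        then show ?thesis using \<open>e > 0\<close> by (metis card.empty mult_nonneg_nonneg of_nat_0 of_nat_0_le_iff order_less_imp_le)
      next
        case False
        then have "real (card (B \<inter> {..<n})) / real n < e" using N[of n] by (simp add: freq_def)
        then have "real (card (B \<inter> {..<n})) \<le> e * real n"
          using False by (simp add: pos_divide_less_eq)
        moreover have "card (B \<inter> - {..<N} \<inter> {..<n}) \<le> card (B \<inter> {..<n})"
          by (intro card_mono) auto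
        ultimately show ?thesis by linarith
      qed
    qed
    ultimately show ?thesis by blast
  next
    case True
    then obtain k where k: "{k} \<in> u" using lessThan_mem_imp_principal[OF u(1)] by blast
    have "{..<m} \<in> density_algebra" by (simp add: density_algebra_iff density_zero_finite)
    then have "\<not> k < m" using density.ultrafilter_mono[OF u(1) k, of "{..<m}"] m(1) by auto
    have "real (card ({k} \<inter> {..<n})) \<le> e * real n" for n
    proof (cases "k < n")
      case True
      then have "e * real m \<le> e * real n" using \<open>\<not> k < m\<close> \<open>e > 0\<close> by simp
      then show ?thesis using m(2) True by simp
    next
      case False
      then show ?thesis using \<open>e > 0\<close> by simp
    qed
    then have "uniformly_small e {k}" by (simp add: uniformly_small_def density_zero_finite)
    with k show ?thesis by blast
  qed
qed

text \<open>A countable union of density zero sets can have any density; geometrically decreasing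
uniform bounds prevent this. The first \<open>N\<close> sets have density zero together, and the
others contribute at most \<open>2 * (1/2)^N\<close> to every frequency.\<close>

lemma density_zero_Union_small:
  assumes "\<And>i. uniformly_small ((1 / 2) ^ i) (A i)"
  shows "density_zero (\<Union>i. A i)"
  unfolding density_zero_def
proof (rule LIMSEQ_I)
  fix r :: real assume "r > 0"
  obtain N where N: "(1 / 2 :: real) ^ N < r / 4"
    using real_arch_pow_inv[of "r / 4" "1 / 2 :: real"] \<open>r > 0\<close> by auto
  have "(\<lambda>n. \<Sum>i<N. freq (A i) n) \<longlonglongrightarrow> (\<Sum>i<N. 0)"
    using assms by (intro tendsto_sum) (auto simp: uniformly_small_def density_zero_def)
  then have "\<forall>\<^sub>F n in sequentially. (\<Sum>i<N. freq (A i) n) < r / 2"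
    using \<open>r > 0\<close> by (intro order_tendstoD(2)) auto
  then obtain K where K: "\<And>n. n \<ge> K \<Longrightarrow> (\<Sum>i<N. freq (A i) n) < r / 2"
    by (auto simp: eventually_sequentially)
  have "norm (freq (\<Union>i. A i) n - 0) < r" if n: "n \<ge> K" "n \<ge> N" "n > 0" for n
  proof -
    \<comment> \<open>A set with index at least n would have fewer than one element below n.\<close>
    have empty: "A i \<inter> {..<n} = {}" if "i \<ge> n" for i
    proof -
      have "real n < 2 ^ i" using that less_exp[of i] by (metis le_less_trans of_nat_less_numeral_power_cancel_iff)
      then have "(1 / 2) ^ i * real n < 1" by (simp add: power_one_over field_simps)
      moreover have "real (card (A i \<inter> {..<n})) \<le> (1 / 2) ^ i * real n"
        using assms[of i] unfolding uniformly_small_def by blast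
      ultimately have "card (A i \<inter> {..<n}) = 0" by linarith
      then show ?thesis by simp
    qed
    have "(\<Union>i. A i) \<inter> {..<n} = (\<Union>i<n. A i \<inter> {..<n})"
    proof (intro equalityI subsetI)
      fix k assume "k \<in> (\<Union>i. A i) \<inter> {..<n}"
      then obtain i where i: "k \<in> A i \<inter> {..<n}" by blast
      then have "i < n" using empty[of i] by (cases "i < n") auto
      with i show "k \<in> (\<Union>i<n. A i \<inter> {..<n})" by blast
    qed blast
    then have "card ((\<Union>i. A i) \<inter> {..<n}) \<le> (\<Sum>i<n. card (A i \<inter> {..<n}))"
      using card_UN_le[of "{..<n}" "\<lambda>i. A i \<inter> {..<n}"] by simp
    then have "real (card ((\<Union>i. A i) \<inter> {..<n})) \<le> (\<Sum>i<n. real (card (A i \<inter> {..<n})))"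
      by (metis of_nat_mono of_nat_sum)
    then have "freq (\<Union>i. A i) n \<le> (\<Sum>i<n. real (card (A i \<inter> {..<n}))) / real n"
      unfolding freq_def by (rule divide_right_mono) simp
    also have "\<dots> = (\<Sum>i<n. freq (A i) n)"
      by (simp add: freq_def sum_divide_distrib)
    also have "\<dots> = (\<Sum>i<N. freq (A i) n) + (\<Sum>i=N..<n. freq (A i) n)"
      using sum.atLeastLessThan_concat[of 0 N n "\<lambda>i. freq (A i) n"] n(2) by (simp add: atLeast0LessThan)
    also have "(\<Sum>i=N..<n. freq (A i) n) \<le> (\<Sum>i=N..<n. (1 / 2) ^ i)"
      using assms n(3) by (intro sum_mono) (auto simp: freq_def uniformly_small_def divide_le_eq)
    also have "(\<Sum>i=N..<n. (1 / 2 :: real) ^ i) \<le> 2 * (1 / 2) ^ N"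
    proof -
      have "(\<Sum>i=N..<n. (1 / 2 :: real) ^ i) = 2 * (1 / 2) ^ N - 2 * (1 / 2) ^ n"
        using n(2) by (induction n rule: dec_induct) auto
      then show ?thesis by simp
    qed
    finally show ?thesis using K[OF n(1)] N freq_nonneg[of "\<Union>i. A i" n] by auto
  qed
  then show "\<exists>M. \<forall>n\<ge>M. norm (freq (\<Union>i. A i) n - 0) < r"
    by (intro exI[of _ "K + N + 1"]) auto
qed

text \<open>Discard the finitely many points of \<open>X\<close> that need not have a small member.
A set \<open>B\<close> that distinguishes two of the remaining points splits the rest into two
nonempty parts, one of which is infinite. A point in the other part has a small member, and its
trace on that side of the split misses the infinite part.\<close>

lemma small_set_missing_infinitely_many:
  assumes X: "infinite X" "\<And>u. u \<in> X \<Longrightarrow> density_ultrafilter u" and "e > 0"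
  shows "\<exists>u\<in>X. \<exists>A\<in>u. uniformly_small e A \<and> infinite {v \<in> X. A \<notin> v}"
proof -
  obtain m where m: "1 \<le> e * real m"
    using reals_Archimedean3[OF \<open>e > 0\<close>] by (metis less_eq_real_def mult.commute)
  define X' where "X' = {u \<in> X. u \<noteq> density_one_point \<and> {..<m} \<notin> u}"
  have "X - X' \<subseteq> {density_one_point} \<union> {u. density_ultrafilter u \<and> {..<m} \<in> u}"
    using X(2) by (auto simp: X'_def)
  then have "finite (X - X')"
    by (rule finite_subset) (use finite_ultrafilters_lessThan in simp)
  then have inf: "infinite X'" using X(1) by (metis Diff_infinite_finite Diff_Diff_Int X'_def inf_absorb2 mem_Collect_eq subsetI)
  then obtain u where u: "u \<in> X'" by (metis infinite_imp_nonempty ex_in_conv)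
  have "infinite (X' - {u})" using inf by simp
  then obtain v where v: "v \<in> X'" "v \<noteq> u" by (metis infinite_imp_nonempty ex_in_conv Diff_iff singletonI)
  have uf: "\<And>w. w \<in> X' \<Longrightarrow> density_ultrafilter w" using X(2) by (simp add: X'_def)
  have small: "\<exists>A\<in>w. uniformly_small e A" if "w \<in> X'" for w
    using uniformly_small_member[OF uf[OF that] _ _ m] that by (simp add: X'_def)
  have step: ?thesis if w: "w \<in> X'" "B \<in> w" "B \<in> density_algebra" "infinite {v \<in> X'. B \<notin> v}" for w B
  proof -
    obtain A where A: "A \<in> w" "uniformly_small e A" using small[OF w(1)] by blast
    have AD: "A \<in> density_algebra" using A(2) by (rule uniformly_small_in_algebra)
    have "A \<inter> B \<in> w" using density.ultrafilter_Int_iff[OF uf[OF w(1)] AD w(3)] A w by blast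
    moreover have "uniformly_small e (A \<inter> B)" using A(2) by (rule uniformly_small_subset) blast
    moreover have "{v \<in> X'. B \<notin> v} \<subseteq> {v \<in> X. A \<inter> B \<notin> v}"
      using density.ultrafilter_Int_iff[OF uf AD w(3)] by (auto simp: X'_def)
    ultimately have "infinite {v \<in> X. A \<inter> B \<notin> v}" using w(4) finite_subset by blast
    moreover have "w \<in> X" using w(1) by (simp add: X'_def)
    ultimately show ?thesis using \<open>A \<inter> B \<in> w\<close> \<open>uniformly_small e (A \<inter> B)\<close> by blast
  qed
  obtain B where B: "B \<in> density_algebra" "B \<in> u" "B \<notin> v"
    using density.ultrafilter_neqE[OF uf[OF u] uf[OF v(1)]] v(2) by metis
  have "X' = {w \<in> X'. B \<in> w} \<union> {w \<in> X'. B \<notin> w}" by blast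
  then consider "infinite {w \<in> X'. B \<notin> w}" | "infinite {w \<in> X'. B \<in> w}"
    using inf by (metis finite_UnI)
  then show ?thesis
  proof cases
    case 1
    then show ?thesis using step u B by blast
  next
    case 2
    moreover have "{w \<in> X'. B \<in> w} = {w \<in> X'. - B \<notin> w}"
      using density_ultrafilter_Compl_iff[OF uf B(1)] by blast
    ultimately show ?thesis
      using step[OF v(1) _ density_algebra_Compl[OF B(1)]]
        density_ultrafilter_Compl_iff[OF uf[OF v(1)] B(1)] B(3) by metis
  qed
qed

text \<open>Choose points \<open>y n\<close> with small members \<open>A n\<close>, always
continuing inside the infinite set of points that \<open>A n\<close> misses. Subtracting the earlier
sets makes the members disjoint, and since they are uniformly small, the union over any index set
\<open>S\<close> has density zero and therefore belongs to the algebra.\<close>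

lemma infinite_set_contains_independent_sequence:
  assumes X: "infinite X" "\<And>u. u \<in> X \<Longrightarrow> density_ultrafilter u"
  shows "\<exists>y. inj y \<and> range y \<subseteq> X \<and> (\<forall>S. \<exists>A\<in>density_algebra. \<forall>n::nat. A \<in> y n \<longleftrightarrow> n \<in> S)"
proof -
  \<comment> \<open>A stage consists of the reservoir Z, the chosen point u in Z and its small member A.\<close>
  define P where "P n = (\<lambda>(Z, u, A). Z \<subseteq> X \<and> u \<in> Z \<and> A \<in> u \<and> uniformly_small ((1 / 2) ^ n) A
      \<and> infinite {v \<in> Z. A \<notin> v})" for n
  define Q where "Q = (\<lambda>(Z::nat set set set, u::nat set set, A::nat set) (Z', u'::nat set set, A'::nat set). Z' = {v \<in> Z. A \<notin> v})"
  have "\<exists>s. \<forall>n. P n (s n) \<and> Q (s n) (s (Suc n))"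
  proof (rule dependent_nat_choice)
    show "\<exists>t. P 0 t"
      using small_set_missing_infinitely_many[OF X, of 1] unfolding P_def by auto
  next
    fix t n assume "P n t"
    then obtain Z u A where t: "t = (Z, u, A)" "Z \<subseteq> X" "infinite {v \<in> Z. A \<notin> v}"
      unfolding P_def by (cases t) auto
    then have "\<exists>u\<in>{v \<in> Z. A \<notin> v}. \<exists>A'\<in>u. uniformly_small ((1 / 2) ^ Suc n) A' \<and> infinite {v \<in> {v \<in> Z. A \<notin> v}. A' \<notin> v}"
      using X(2) by (intro small_set_missing_infinitely_many) auto
    then obtain u' A' where "P (Suc n) ({v \<in> Z. A \<notin> v}, u', A')"
      using t unfolding P_def by blast
    then show "\<exists>t'. P (Suc n) t' \<and> Q t t'" unfolding Q_def t(1) by auto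
  qed
  then obtain s where s: "\<And>n. P n (s n)" "\<And>n. Q (s n) (s (Suc n))" by blast
  define Z where "Z n = fst (s n)" for n
  define y where "y n = fst (snd (s n))" for n
  define A where "A n = snd (snd (s n))" for n
  have P: "Z n \<subseteq> X" "y n \<in> Z n" "A n \<in> y n" "uniformly_small ((1 / 2) ^ n) (A n)" for n
    using s(1)[of n] unfolding P_def Z_def y_def A_def by (auto split: prod.splits)
  have Z: "Z (Suc n) = {v \<in> Z n. A n \<notin> v}" for n
    using s(2)[of n] unfolding Q_def Z_def A_def by (auto split: prod.splits)
  have "decseq Z" by (rule decseq_SucI) (auto simp: Z)
  have later: "A i \<notin> y n" if "i < n" for i n
  proof -
    have "Z n \<subseteq> Z (Suc i)" using \<open>decseq Z\<close> that unfolding decseq_def by (simp add: Suc_leI)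
    with P(2)[of n] Z[of i] show ?thesis by blast
  qed
  have uf: "density_ultrafilter (y n)" for n using P X(2) by blast
  have AD: "A n \<in> density_algebra" for n using P(4) by (rule uniformly_small_in_algebra)
  define B where "B n = A n \<inter> - (\<Union>i<n. A i)" for n
  have UD: "(\<Union>i<n. A i) \<in> density_algebra" for n using AD by (intro density.finite_UN) auto
  have "(\<Union>i<n. A i) \<notin> y n" for n
    using density.ultrafilter_Union_iff[OF uf, of "{..<n}" A] AD later by auto
  then have By: "B n \<in> y n" for n
    unfolding B_def using density.ultrafilter_Int_iff[OF uf AD density_algebra_Compl[OF UD]]
      density_ultrafilter_Compl_iff[OF uf UD] P(3) by blast
  have disj: "B i \<inter> B n = {}" if "i \<noteq> n" for i n
    using that by (cases i n rule: linorder_cases) (auto simp: B_def)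
  have small: "uniformly_small ((1 / 2) ^ n) (B n)" for n
    using P(4) by (rule uniformly_small_subset) (auto simp: B_def)
  have "\<exists>C\<in>density_algebra. \<forall>n. C \<in> y n \<longleftrightarrow> n \<in> S" for S
  proof (intro bexI allI)
    define C where "C = (\<Union>n\<in>S. B n)"
    have "density_zero C"
      by (rule density_zero_subset[OF density_zero_Union_small[OF small]]) (auto simp: C_def)
    then show C: "C \<in> density_algebra" by (simp add: density_algebra_iff)
    fix n
    show "C \<in> y n \<longleftrightarrow> n \<in> S"
    proof
      assume "C \<in> y n"
      then have "C \<inter> B n \<in> y n"
        using By density.ultrafilter_Int_iff[OF uf C] density.ultrafilter_sub[OF uf] by blast
      then have "C \<inter> B n \<noteq> {}" using density.ultrafilter_empty[OF uf] by metis
      then obtain m where "m \<in> S" "B m \<inter> B n \<noteq> {}" by (auto simp: C_def)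
      then show "n \<in> S" using disj by metis
    next
      assume "n \<in> S"
      then show "C \<in> y n" using density.ultrafilter_mono[OF uf By C] by (auto simp: C_def)
    qed
  qed
  moreover have "inj y"
  proof (rule linorder_injI)
    fix i n :: nat assume "i < n"
    then show "y i \<noteq> y n" using later P(3) by metis
  qed
  ultimately show ?thesis using P by blast
qed

section \<open>Separating two sequences of ultrafilters\<close>

lemma infinite_image_imp_infinite_Collect:
  assumes "infinite Y" "\<And>u. u \<in> Y \<Longrightarrow> \<exists>n\<in>R. x n = u"
  shows "infinite {n \<in> R. x n \<in> Y}"
proof -
  have "Y \<subseteq> x ` {n \<in> R. x n \<in> Y}" using assms(2) by blast
  then show ?thesis using assms(1) finite_surj by blast
qed

text \<open>Independence of a sequence of values, applied to the even indices, gives a clopen set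
that both contains and misses infinitely many terms.\<close>

lemma clopen_halving_sequence:
  assumes R: "infinite R" and x: "\<And>n. n \<in> R \<Longrightarrow> density_ultrafilter (x n)"
    and fin: "\<And>c. finite {n \<in> R. x n = c}"
  shows "\<exists>B\<in>density_algebra. infinite {n \<in> R. B \<in> x n} \<and> infinite {n \<in> R. B \<notin> x n}"
proof -
  have "infinite (x ` R)" using pigeonhole_infinite[OF R, of x] fin by blast
  then obtain y where y: "inj y" "range y \<subseteq> x ` R"
      "\<forall>S. \<exists>A\<in>density_algebra. \<forall>n::nat. A \<in> y n \<longleftrightarrow> n \<in> S"
    using infinite_set_contains_independent_sequence[of "x ` R"] x by blast
  then obtain B where B: "B \<in> density_algebra" "\<And>n. B \<in> y n \<longleftrightarrow> even n"
    by (metis mem_Collect_eq)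
  have "inj (\<lambda>k. y (2 * k))" "inj (\<lambda>k. y (2 * k + 1))"
    using y(1) by (auto intro!: injI dest!: injD[OF y(1)])
  then have inf: "infinite (range (\<lambda>k. y (2 * k)))" "infinite (range (\<lambda>k. y (2 * k + 1)))"
    by (simp_all only: range_inj_infinite not_False_eq_True)
  have "infinite {n \<in> R. x n \<in> range (\<lambda>k. y (2 * k))}" "infinite {n \<in> R. x n \<in> range (\<lambda>k. y (2 * k + 1))}"
    using y(2) by (intro infinite_image_imp_infinite_Collect inf; fastforce)+
  moreover have "{n \<in> R. x n \<in> range (\<lambda>k. y (2 * k))} \<subseteq> {n \<in> R. B \<in> x n}"
    "{n \<in> R. x n \<in> range (\<lambda>k. y (2 * k + 1))} \<subseteq> {n \<in> R. B \<notin> x n}"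
    using B(2) by auto
  ultimately show ?thesis using B(1) finite_subset by blast
qed

text \<open>Unless \<open>z\<close> itself repeats a value infinitely often, a clopen set that
halves \<open>z\<close> has one side that does not contain \<open>c\<close> but contains infinitely
many terms.\<close>

lemma separate_from_constant:
  assumes R: "infinite R" and c: "density_ultrafilter c"
    and z: "\<And>n. n \<in> R \<Longrightarrow> density_ultrafilter (z n)" "\<And>n. n \<in> R \<Longrightarrow> z n \<noteq> c"
  shows "\<exists>S\<subseteq>R. \<exists>C\<in>density_algebra. infinite S \<and> C \<in> c \<and> (\<forall>n\<in>S. C \<notin> z n)"
proof (cases "\<exists>d. infinite {n \<in> R. z n = d}")
  case True
  then obtain d where d: "infinite {n \<in> R. z n = d}" by blast
  then obtain n where n: "n \<in> R" "z n = d" using not_finite_existsD by auto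
  then obtain C where "C \<in> density_algebra" "C \<in> c" "C \<notin> d"
    using density.ultrafilter_neqE[OF c] z by metis
  then have "\<forall>n\<in>{n \<in> R. z n = d}. C \<notin> z n" by simp
  moreover have "{n \<in> R. z n = d} \<subseteq> R" by blast
  ultimately show ?thesis using d \<open>C \<in> density_algebra\<close> \<open>C \<in> c\<close>
    by (intro exI[of _ "{n \<in> R. z n = d}"] conjI bexI[of _ C])
next
  case False
  then have fin: "finite {n \<in> R. z n = d}" for d by simp
  have "\<exists>B\<in>density_algebra. infinite {n \<in> R. B \<in> z n} \<and> infinite {n \<in> R. B \<notin> z n}"
    by (rule clopen_halving_sequence[OF R _ fin], rule z(1))
  then obtain B where B: "B \<in> density_algebra" "infinite {n \<in> R. B \<in> z n}" "infinite {n \<in> R. B \<notin> z n}"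
    by (elim bexE conjE)
  show ?thesis
  proof (cases "B \<in> c")
    case True
    have "{n \<in> R. B \<notin> z n} \<subseteq> R" "\<forall>n\<in>{n \<in> R. B \<notin> z n}. B \<notin> z n" by auto
    with True B(1,3) show ?thesis
      by (intro exI[of _ "{n \<in> R. B \<notin> z n}"] conjI bexI[of _ B])
  next
    case False
    have "- B \<in> c" using density_ultrafilter_Compl_iff[OF c B(1)] False by simp
    moreover have "\<forall>n\<in>{n \<in> R. B \<in> z n}. - B \<notin> z n"
      using density_ultrafilter_Compl_iff B(1) z(1) by blast
    moreover have "{n \<in> R. B \<in> z n} \<subseteq> R" by blast
    ultimately show ?thesis using B(2) density_algebra_Compl[OF B(1)]
      by (intro exI[of _ "{n \<in> R. B \<in> z n}"] conjI bexI[of _ "- B"])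
  qed
qed

lemma finite_Collect_member_finite:
  assumes "finite F" "\<And>c. finite {n \<in> R. x n = c}"
  shows "finite {n \<in> R. x n \<in> F}"
proof -
  have "{n \<in> R. x n \<in> F} = (\<Union>c\<in>F. {n \<in> R. x n = c})" by blast
  then show ?thesis using assms by simp
qed

text \<open>One step of the recursion below. The set \<open>A\<close> is to become part of the
separating set and must therefore be missing from \<open>z s\<close> and from \<open>z r\<close> for
the indices \<open>r\<close> that are kept. The set \<open>D\<close> protects \<open>z s\<close>
from all later parts: it is not in \<open>z s\<close>, and later parts will be shrunk into
\<open>D\<close>, which is possible because \<open>D\<close> belongs to every \<open>x r\<close>
that is kept. To keep infinitely many \<open>r\<close>, halve \<open>z\<close> and put
\<open>A\<close> inside the half that belongs to \<open>x s\<close>; then halve \<open>x\<close> and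
let \<open>D\<close> be a half that is not in \<open>z s\<close>.\<close>

lemma separation_step:
  assumes T: "infinite T" and "e > 0"
    and x: "\<And>n. n \<in> T \<Longrightarrow> density_ultrafilter (x n)" "\<And>n. n \<in> T \<Longrightarrow> x n \<noteq> density_one_point"
    and z: "\<And>n. n \<in> T \<Longrightarrow> density_ultrafilter (z n)"
    and xz: "\<And>n. n \<in> T \<Longrightarrow> x n \<noteq> z n"
    and fin: "\<And>c. finite {n \<in> T. x n = c}" "\<And>c. finite {n \<in> T. z n = c}"
  shows "\<exists>s\<in>T. \<exists>A\<in>x s. \<exists>D\<in>density_algebra. uniformly_small e A \<and> A \<notin> z s \<and> D \<notin> z s \<and>
           infinite {r \<in> T. r \<noteq> s \<and> A \<notin> z r \<and> D \<in> x r}"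
proof -
  obtain m where m: "1 \<le> e * real m"
    using reals_Archimedean3[OF \<open>e > 0\<close>] by (metis less_eq_real_def mult.commute)
  have "\<exists>B\<in>density_algebra. infinite {n \<in> T. B \<in> z n} \<and> infinite {n \<in> T. B \<notin> z n}"
    by (rule clopen_halving_sequence[OF T _ fin(2)], rule z)
  then obtain B where B: "B \<in> density_algebra" "infinite {n \<in> T. B \<in> z n}" "infinite {n \<in> T. B \<notin> z n}"
    by (elim bexE conjE)
  have "finite {n \<in> T. x n \<in> {u. density_ultrafilter u \<and> {..<m} \<in> u}}"
    by (rule finite_Collect_member_finite[OF finite_ultrafilters_lessThan fin(1)])
  then have "\<not> T \<subseteq> {n \<in> T. x n \<in> {u. density_ultrafilter u \<and> {..<m} \<in> u}}"
    using T finite_subset by blast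
  then obtain s where s: "s \<in> T" "{..<m} \<notin> x s" using x(1) by blast
  note us = x(1)[OF s(1)]
  obtain A0 where A0: "A0 \<in> x s" "uniformly_small e A0"
    using uniformly_small_member[OF us x(2)[OF s(1)] s(2) m] by blast
  obtain C where C: "C \<in> density_algebra" "C \<in> x s" "C \<notin> z s"
    using density.ultrafilter_neqE[OF us z[OF s(1)] xz[OF s(1)]] .
  define B' where "B' = (if B \<in> x s then B else - B)"
  have B': "B' \<in> density_algebra" "B' \<in> x s"
    using B(1) density_algebra_Compl[OF B(1)] density_ultrafilter_Compl_iff[OF us B(1)]
    by (auto simp: B'_def)
  have B'inf: "infinite {n \<in> T. B' \<notin> z n}"
  proof (cases "B \<in> x s")
    case True
    then show ?thesis using B(3) by (simp add: B'_def)
  next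
    case False
    have "{n \<in> T. B \<in> z n} \<subseteq> {n \<in> T. B' \<notin> z n}"
      using density_ultrafilter_Compl_iff[OF z B(1)] False by (auto simp: B'_def)
    then show ?thesis using B(2) finite_subset by blast
  qed
  define A where "A = A0 \<inter> (C \<inter> B')"
  have A0D: "A0 \<in> density_algebra" using A0(2) by (rule uniformly_small_in_algebra)
  have CB: "C \<inter> B' \<in> density_algebra" using C(1) B'(1) by blast
  have A_iff: "A \<in> u \<longleftrightarrow> A0 \<in> u \<and> C \<in> u \<and> B' \<in> u" if "density_ultrafilter u" for u
    unfolding A_def using density.ultrafilter_Int_iff[OF that A0D CB]
      density.ultrafilter_Int_iff[OF that C(1) B'(1)] by blast
  have A: "A \<in> x s" "A \<notin> z s" "uniformly_small e A"
    using A_iff[OF us] A_iff[OF z[OF s(1)]] A0 B' C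
    by (auto simp: A_def intro: uniformly_small_subset)
  define T' where "T' = {r \<in> T. A \<notin> z r}"
  have "{n \<in> T. B' \<notin> z n} \<subseteq> T'" using A_iff[OF z] by (auto simp: T'_def)
  then have T': "infinite T'" "T' \<subseteq> T" using B'inf finite_subset by (blast, simp add: T'_def)
  have "finite {n \<in> T'. x n = c}" for c
    using fin(1)[of c] T'(2) by (auto intro: rev_finite_subset)
  then obtain E where E: "E \<in> density_algebra" "infinite {n \<in> T'. E \<in> x n}" "infinite {n \<in> T'. E \<notin> x n}"
    using clopen_halving_sequence[OF T'(1), of x] x(1) T'(2) by blast
  define D where "D = (if E \<in> z s then - E else E)"
  have D: "D \<in> density_algebra" "D \<notin> z s"
    using E(1) density_algebra_Compl[OF E(1)] density_ultrafilter_Compl_iff[OF z[OF s(1)] E(1)]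
    by (auto simp: D_def)
  have "infinite {r \<in> T'. D \<in> x r}"
  proof (cases "E \<in> z s")
    case True
    have "{n \<in> T'. E \<notin> x n} \<subseteq> {r \<in> T'. D \<in> x r}"
      using density_ultrafilter_Compl_iff[OF x(1) E(1)] True T'(2) by (auto simp: D_def)
    then show ?thesis using E(3) finite_subset by blast
  next
    case False
    then show ?thesis using E(2) by (simp add: D_def)
  qed
  then have "infinite ({r \<in> T'. D \<in> x r} - {s})" by simp
  also have "{r \<in> T'. D \<in> x r} - {s} = {r \<in> T. r \<noteq> s \<and> A \<notin> z r \<and> D \<in> x r}"
    by (auto simp: T'_def)
  finally show ?thesis using s(1) A D
    by (intro bexI[of _ s] bexI[of _ A] bexI[of _ D] conjI)
qed

text \<open>Iterating the previous step gives indices \<open>s n\<close> and sets \<open>A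
n\<close>, \<open>D n\<close>. The separating set is the union of the \<open>A n\<close>, each
shrunk to lie in all earlier \<open>D i\<close>. It has density zero because the \<open>A n\<close>
are uniformly small. It is not in \<open>z (s n)\<close>, because it is covered by \<open>D
n\<close> and the finitely many sets \<open>A i\<close> with \<open>i \<le> n\<close>, none of which
is in \<open>z (s n)\<close>.\<close>

lemma separate_finite_to_one_sequences:
  fixes x z :: "nat \<Rightarrow> nat set set"
  assumes R: "infinite R"
    and x: "\<And>n. n \<in> R \<Longrightarrow> density_ultrafilter (x n)"
    and z: "\<And>n. n \<in> R \<Longrightarrow> density_ultrafilter (z n)"
    and xz: "\<And>n. n \<in> R \<Longrightarrow> x n \<noteq> z n"
    and fin: "\<And>c. finite {n \<in> R. x n = c}" "\<And>c. finite {n \<in> R. z n = c}"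
  shows "\<exists>S\<subseteq>R. \<exists>C\<in>density_algebra. infinite S \<and> (\<forall>n\<in>S. C \<in> x n \<and> C \<notin> z n)"
proof -
  define R0 where "R0 = {n \<in> R. x n \<noteq> density_one_point}"
  have "R - R0 = {n \<in> R. x n = density_one_point}" by (auto simp: R0_def)
  then have "finite (R - R0)" using fin(1) by simp
  then have R0: "infinite R0" using R by (metis Diff_infinite_finite Diff_Diff_Int R0_def inf_absorb2 mem_Collect_eq subsetI)
  have R0R: "R0 \<subseteq> R" by (auto simp: R0_def)
  define next_set where "next_set T s A D = {r \<in> T. r \<noteq> s \<and> A \<notin> z r \<and> D \<in> x r}"
    for T s A D
  define P where "P n = (\<lambda>(T, s, A, D). T \<subseteq> R0 \<and> s \<in> T \<and> A \<in> x s \<and> D \<in> density_algebra \<and>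
      uniformly_small ((1 / 2) ^ n) A \<and> A \<notin> z s \<and> D \<notin> z s \<and> infinite (next_set T s A D))" for n
  define Q where "Q = (\<lambda>(T, s, A, D) (T' :: nat set, s' :: nat, A' :: nat set, D' :: nat set).
      T' = next_set T s A D)"
  have step: "\<exists>s A D. P n (T, s, A, D)" if T: "infinite T" "T \<subseteq> R0" for n T
  proof -
    have "finite {n \<in> T. x n = c}" "finite {n \<in> T. z n = c}" for c
      using fin[of c] R0R T(2) by (auto intro: rev_finite_subset)
    then have "\<exists>s\<in>T. \<exists>A\<in>x s. \<exists>D\<in>density_algebra. uniformly_small ((1 / 2) ^ n) A \<and> A \<notin> z s \<and>
        D \<notin> z s \<and> infinite {r \<in> T. r \<noteq> s \<and> A \<notin> z r \<and> D \<in> x r}"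
      using T x z xz R0R by (intro separation_step) (auto simp: R0_def)
    then show ?thesis unfolding P_def next_set_def using T(2) by blast
  qed
  have "\<exists>t. \<forall>n. P n (t n) \<and> Q (t n) (t (Suc n))"
  proof (rule dependent_nat_choice)
    show "\<exists>t. P 0 t" using step[OF R0 order_refl] by blast
  next
    fix t n assume "P n t"
    obtain T s A D where t: "t = (T, s, A, D)" by (cases t) auto
    with \<open>P n t\<close> have "infinite (next_set T s A D)" "next_set T s A D \<subseteq> R0"
      unfolding P_def next_set_def by auto
    from step[OF this] obtain s' A' D' where "P (Suc n) (next_set T s A D, s', A', D')" by blast
    then show "\<exists>t'. P (Suc n) t' \<and> Q t t'" unfolding Q_def t by blast
  qed
  then obtain t where t: "\<And>n. P n (t n)" "\<And>n. Q (t n) (t (Suc n))" by blast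
  define T where "T n = fst (t n)" for n
  define s where "s n = fst (snd (t n))" for n
  define A where "A n = fst (snd (snd (t n)))" for n
  define D where "D n = snd (snd (snd (t n)))" for n
  have P: "T n \<subseteq> R0" "s n \<in> T n" "A n \<in> x (s n)" "D n \<in> density_algebra"
      "uniformly_small ((1 / 2) ^ n) (A n)" "A n \<notin> z (s n)" "D n \<notin> z (s n)" for n
    using t(1)[of n] unfolding P_def T_def s_def A_def D_def by (auto split: prod.splits)
  have T: "T (Suc n) = next_set (T n) (s n) (A n) (D n)" for n
    using t(2)[of n] unfolding Q_def T_def s_def A_def D_def by (auto split: prod.splits)
  have "decseq T" by (rule decseq_SucI) (auto simp: T next_set_def)
  have later: "s n \<noteq> s i" "A i \<notin> z (s n)" "D i \<in> x (s n)" if "i < n" for i n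
  proof -
    have "T n \<subseteq> T (Suc i)" using \<open>decseq T\<close> that unfolding decseq_def by (simp add: Suc_leI)
    with P(2)[of n] have "s n \<in> next_set (T i) (s i) (A i) (D i)" using T[of i] by blast
    then show "s n \<noteq> s i" "A i \<notin> z (s n)" "D i \<in> x (s n)" by (simp_all add: next_set_def)
  qed
  have sR: "s n \<in> R" for n using P(1,2) R0R by blast
  note ux = x[OF sR] and uz = z[OF sR]
  have AD: "A n \<in> density_algebra" for n using P(5) by (rule uniformly_small_in_algebra)
  \<comment> \<open>Removing E n from A n shrinks it into every earlier D i.\<close>
  define E where "E n = (\<Union>i<n. - D i)" for n
  have ED: "E n \<in> density_algebra" for n
    unfolding E_def using P(4) density_algebra_Compl by (intro density.finite_UN) auto
  have "E n \<notin> x (s n)" for n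
    unfolding E_def
    using density.ultrafilter_Union_iff[OF ux, of "{..<n}" "\<lambda>i. - D i"] P(4)
      density_algebra_Compl density_ultrafilter_Compl_iff[OF ux P(4)] later(3) by auto
  then have B: "A n \<inter> - E n \<in> x (s n)" for n
    using density.ultrafilter_Int_iff[OF ux AD density_algebra_Compl[OF ED]]
      density_ultrafilter_Compl_iff[OF ux ED] P(3) by blast
  define C where "C = (\<Union>n. A n \<inter> - E n)"
  have "density_zero C"
    unfolding C_def
    by (rule density_zero_Union_small, rule uniformly_small_subset[OF P(5)]) blast
  then have CD: "C \<in> density_algebra" by (simp add: density_algebra_iff)
  have "C \<in> x (s n)" for n
    using density.ultrafilter_mono[OF ux B CD] by (auto simp: C_def)
  moreover have "C \<notin> z (s n)" for n
  proof
    assume "C \<in> z (s n)"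
    have UD: "(\<Union>i<Suc n. A i) \<in> density_algebra" using AD by (intro density.finite_UN) auto
    have "C \<subseteq> (\<Union>i<Suc n. A i) \<union> D n"
    proof
      fix k assume "k \<in> C"
      then obtain i where i: "k \<in> A i" "k \<notin> E i" by (auto simp: C_def)
      then show "k \<in> (\<Union>i<Suc n. A i) \<union> D n"
        by (cases "i < Suc n") (auto simp: E_def)
    qed
    then have "(\<Union>i<Suc n. A i) \<union> D n \<in> z (s n)"
      using density.ultrafilter_mono[OF uz \<open>C \<in> z (s n)\<close> density.Un[OF UD P(4)]] by blast
    then have "(\<Union>i<Suc n. A i) \<in> z (s n)"
      using density.ultrafilter_Un_iff[OF uz UD P(4)] P(7) by blast
    then obtain i where "i < Suc n" "A i \<in> z (s n)"
      using density.ultrafilter_Union_iff[OF uz, of "{..<Suc n}" A] AD by auto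
    then show False using P(6)[of n] later(2)[of i n] by (auto simp: less_Suc_eq)
  qed
  ultimately have C: "\<forall>n\<in>range s. C \<in> x n \<and> C \<notin> z n" by simp
  have "inj s" by (rule linorder_injI) (use later(1) in metis)
  then have "infinite (range s)" by (rule range_inj_infinite)
  moreover have "range s \<subseteq> R" using sR by auto
  ultimately show ?thesis using CD C
    by (intro exI[of _ "range s"] conjI bexI[of _ C])
qed

text \<open>This carries both the absence of convergent sequences and the growth of supports. It
fails in any space with a nontrivial convergent sequence, as the case of constant \<open>z\<close>
shows.\<close>

lemma separate_sequences:
  fixes x z :: "nat \<Rightarrow> nat set set"
  assumes R: "infinite R"
    and x: "\<And>n. n \<in> R \<Longrightarrow> density_ultrafilter (x n)"
    and z: "\<And>n. n \<in> R \<Longrightarrow> density_ultrafilter (z n)"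
    and xz: "\<And>n. n \<in> R \<Longrightarrow> x n \<noteq> z n"
  shows "\<exists>S\<subseteq>R. \<exists>C\<in>density_algebra. infinite S \<and> (\<forall>n\<in>S. C \<in> x n \<and> C \<notin> z n)"
proof -
  consider c where "infinite {n \<in> R. x n = c}" | c where "infinite {n \<in> R. z n = c}"
    | "\<And>c. finite {n \<in> R. x n = c}" "\<And>c. finite {n \<in> R. z n = c}"
    by blast
  then show ?thesis
  proof cases
    case (1 c)
    then obtain n where "n \<in> R" "x n = c" using not_finite_existsD by blast
    then have "density_ultrafilter c" using x by blast
    then have "\<exists>S\<subseteq>{n \<in> R. x n = c}. \<exists>C\<in>density_algebra. infinite S \<and> C \<in> c \<and> (\<forall>n\<in>S. C \<notin> z n)"
      using 1 z xz by (intro separate_from_constant) auto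
    then obtain S C where "S \<subseteq> {n \<in> R. x n = c}" "C \<in> density_algebra" "infinite S" "C \<in> c" "\<forall>n\<in>S. C \<notin> z n"
      by blast
    moreover from this have "S \<subseteq> R" "\<forall>n\<in>S. C \<in> x n \<and> C \<notin> z n" by auto
    ultimately show ?thesis by (intro exI[of _ S] conjI bexI[of _ C])
  next
    case (2 c)
    then obtain n where "n \<in> R" "z n = c" using not_finite_existsD by blast
    then have c: "density_ultrafilter c" using z by blast
    then have "\<exists>S\<subseteq>{n \<in> R. z n = c}. \<exists>C\<in>density_algebra. infinite S \<and> C \<in> c \<and> (\<forall>n\<in>S. C \<notin> x n)"
      using 2 x xz by (intro separate_from_constant) auto
    then obtain S C where S: "S \<subseteq> {n \<in> R. z n = c}" "C \<in> density_algebra" "infinite S" "C \<in> c" "\<forall>n\<in>S. C \<notin> x n"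
      by blast
    have "- C \<in> x n \<and> - C \<notin> z n" if "n \<in> S" for n
    proof -
      have "n \<in> R" "z n = c" using S(1) that by auto
      then show ?thesis
        using S(4,5) that density_ultrafilter_Compl_iff[OF c S(2)] density_ultrafilter_Compl_iff[OF x S(2)]
        by auto
    qed
    then have "\<forall>n\<in>S. - C \<in> x n \<and> - C \<notin> z n" by simp
    moreover have "S \<subseteq> R" using S(1) by blast
    ultimately show ?thesis using S(3) density_algebra_Compl[OF S(2)]
      by (intro exI[of _ S] conjI bexI[of _ "- C"])
  next
    case 3
    show ?thesis by (rule separate_finite_to_one_sequences[OF R x z xz 3])
  qed
qed

text \<open>Separate \<open>x n\<close> from one element of \<open>G n\<close> at a time, passing to
an infinite set of indices each time. The bound \<open>k\<close> makes this stop.\<close>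

lemma separate_from_bounded_sets:
  fixes x :: "nat \<Rightarrow> nat set set"
  assumes "infinite R"
    and "\<And>n. n \<in> R \<Longrightarrow> density_ultrafilter (x n)"
    and "\<And>n. n \<in> R \<Longrightarrow> finite (G n) \<and> card (G n) \<le> k"
    and "\<And>n u. n \<in> R \<Longrightarrow> u \<in> G n \<Longrightarrow> density_ultrafilter u \<and> u \<noteq> x n"
  shows "\<exists>S\<subseteq>R. \<exists>C\<in>density_algebra. infinite S \<and> (\<forall>n\<in>S. C \<in> x n \<and> (\<forall>u\<in>G n. C \<notin> u))"
  using assms
proof (induction k arbitrary: R G)
  case 0
  have "\<forall>n\<in>R. UNIV \<in> x n \<and> (\<forall>u\<in>G n. UNIV \<notin> u)"
    using density.ultrafilter_space 0 by fastforce
  then show ?case using 0(1) density.top order_refl[of R]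
    by (intro exI[of _ R] conjI bexI[of _ UNIV])
next
  case (Suc k)
  show ?case
  proof (cases "infinite {n \<in> R. G n = {}}")
    case True
    have "\<forall>n\<in>{n \<in> R. G n = {}}. UNIV \<in> x n \<and> (\<forall>u\<in>G n. UNIV \<notin> u)"
      using density.ultrafilter_space Suc.prems(2) by simp
    moreover have "{n \<in> R. G n = {}} \<subseteq> R" by blast
    ultimately show ?thesis using True density.top
      by (intro exI[of _ "{n \<in> R. G n = {}}"] conjI bexI[of _ UNIV])
  next
    case False
    define R' where "R' = {n \<in> R. G n \<noteq> {}}"
    have "R = R' \<union> {n \<in> R. G n = {}}" by (auto simp: R'_def)
    then have R': "infinite R'" using False Suc.prems(1) by (metis finite_UnI)
    define z where "z n = (SOME u. u \<in> G n)" for n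
    have zG: "z n \<in> G n" if "n \<in> R'" for n
      unfolding z_def using that by (simp add: R'_def some_in_eq)
    have R'R: "R' \<subseteq> R" by (auto simp: R'_def)
    have "\<exists>S\<subseteq>R'. \<exists>C\<in>density_algebra. infinite S \<and> (\<forall>n\<in>S. C \<in> x n \<and> C \<notin> z n)"
      by (intro separate_sequences R') (use Suc.prems(2,4) zG R'R in \<open>blast+\<close>)
    then obtain S1 C1 where 1: "S1 \<subseteq> R'" "C1 \<in> density_algebra" "infinite S1"
        "\<forall>n\<in>S1. C1 \<in> x n \<and> C1 \<notin> z n" by blast
    have card: "finite (G n - {z n}) \<and> card (G n - {z n}) \<le> k" if "n \<in> S1" for n
    proof -
      have n: "n \<in> R" "n \<in> R'" using that 1(1) R'R by auto
      have "finite (G n)" "card (G n) \<le> Suc k" using Suc.prems(3)[OF n(1)] by auto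
      moreover have "card (G n - {z n}) = card (G n) - 1"
        using zG[OF n(2)] by (rule card_Diff_singleton)
      ultimately show ?thesis by simp
    qed
    have "\<exists>S\<subseteq>S1. \<exists>C\<in>density_algebra. infinite S \<and> (\<forall>n\<in>S. C \<in> x n \<and> (\<forall>u\<in>G n - {z n}. C \<notin> u))"
    proof (rule Suc.IH[OF 1(3) _ card])
      fix n u assume n: "n \<in> S1"
      then have "n \<in> R" using 1(1) R'R by blast
      then show "density_ultrafilter (x n)" by (rule Suc.prems(2))
      assume "u \<in> G n - {z n}"
      then show "density_ultrafilter u \<and> u \<noteq> x n" using Suc.prems(4)[OF \<open>n \<in> R\<close>] by blast
    qed
    then obtain S C where 2: "S \<subseteq> S1" "C \<in> density_algebra" "infinite S"
        "\<forall>n\<in>S. C \<in> x n \<and> (\<forall>u\<in>G n - {z n}. C \<notin> u)" by blast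
    have "C1 \<inter> C \<in> x n \<and> (\<forall>u\<in>G n. C1 \<inter> C \<notin> u)" if "n \<in> S" for n
    proof -
      have n: "n \<in> R" "n \<in> S1" using that 2(1) 1(1) R'R by auto
      have iff: "C1 \<inter> C \<in> u \<longleftrightarrow> C1 \<in> u \<and> C \<in> u" if "density_ultrafilter u" for u
        by (rule density.ultrafilter_Int_iff[OF that 1(2) 2(2)])
      have "C1 \<inter> C \<in> x n" using iff[OF Suc.prems(2)[OF n(1)]] 1(4) 2(4) n(2) that by blast
      moreover have "C1 \<inter> C \<notin> u" if "u \<in> G n" for u
        using iff[of u] Suc.prems(4)[OF n(1) that] 1(4) 2(4) n(2) that \<open>n \<in> S\<close>
        by (cases "u = z n") auto
      ultimately show ?thesis by blast
    qed
    then have "\<forall>n\<in>S. C1 \<inter> C \<in> x n \<and> (\<forall>u\<in>G n. C1 \<inter> C \<notin> u)" by simp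
    moreover have "S \<subseteq> R" using 2(1) 1(1) R'R by blast
    moreover have "C1 \<inter> C \<in> density_algebra" using 1(2) 2(2) by blast
    ultimately show ?thesis using 2(3)
      by (intro exI[of _ S] conjI bexI[of _ "C1 \<inter> C"])
  qed
qed

section \<open>Finitely supported signed measures\<close>

lemma sigma_algebra_borel_sets: "sigma_algebra (topspace K) (borel_sets K)"
  unfolding borel_sets_def
  by (rule sigma_algebra_sigma_sets) (auto dest: openin_subset)

lemma borel_sets_subset: "A \<in> borel_sets K \<Longrightarrow> A \<subseteq> topspace K"
  unfolding borel_sets_def
  by (rule sigma_sets_into_sp) (auto dest: openin_subset)

lemma openin_borel_sets: "openin K U \<Longrightarrow> U \<in> borel_sets K"
  unfolding borel_sets_def by (rule sigma_sets.Basic) simp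

lemma borel_sets_Diff: "A \<in> borel_sets K \<Longrightarrow> B \<in> borel_sets K \<Longrightarrow> A - B \<in> borel_sets K"
  using ring_of_sets.Diff[OF algebra.axioms(1)[OF sigma_algebra.axioms(1)[OF sigma_algebra_borel_sets]]] .

lemma borel_sets_Int: "A \<in> borel_sets K \<Longrightarrow> B \<in> borel_sets K \<Longrightarrow> A \<inter> B \<in> borel_sets K"
  by (metis Diff_Diff_Int borel_sets_Diff)

lemma closedin_borel_sets:
  assumes "closedin K C"
  shows "C \<in> borel_sets K"
proof -
  have "topspace K - (topspace K - C) = C"
    using closedin_subset[OF assms] by blast
  then show ?thesis
    using assms borel_sets_Diff[OF openin_borel_sets[OF openin_topspace] openin_borel_sets]
    unfolding closedin_def by metis
qed

lemma finite_borel_sets: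
  assumes "Hausdorff_space K" "finite F" "F \<subseteq> topspace K"
  shows "F \<in> borel_sets K"
proof -
  have "compactin K F" by (rule finite_imp_compactin[OF assms(3,2)])
  then show ?thesis using assms(1) compactin_imp_closedin closedin_borel_sets by blast
qed

definition discrete_measure :: "'a set \<Rightarrow> ('a \<Rightarrow> real) \<Rightarrow> 'a set \<Rightarrow> real" where
  "discrete_measure F w A = (\<Sum>x\<in>F. w x * of_bool (x \<in> A))"

lemma discrete_measure_Un_sums:
  assumes "disjoint_family A"
  shows "(\<lambda>n. discrete_measure F w (A n)) sums discrete_measure F w (\<Union>n. A n)"
  unfolding discrete_measure_def
proof (rule sums_sum)
  fix x
  show "(\<lambda>n. w x * of_bool (x \<in> A n)) sums (w x * of_bool (x \<in> (\<Union>n. A n)))"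
  proof (cases "x \<in> (\<Union>n. A n)")
    case True
    then obtain m where m: "x \<in> A m" by blast
    have "x \<notin> A n" if "n \<noteq> m" for n
      using disjoint_family_onD[OF assms _ _ that] m by blast
    then have "(\<lambda>n. w x * of_bool (x \<in> A n)) = (\<lambda>n. if n = m then w x else 0)"
      using m by auto
    then show ?thesis using True sums_single[of m "\<lambda>_. w x"] by simp
  next
    case False
    then show ?thesis by simp
  qed
qed

text \<open>The supremum is attained at the finite, hence Borel, set of points in \<open>A\<close>
with positive weight. The measure \<open>\<mu>\<close> is only assumed to agree with the weighted
sum on Borel sets, since an abstract Radon measure may take arbitrary values elsewhere.\<close>

lemma upper_variation_discrete:
  assumes K: "Hausdorff_space K" and F: "finite F" "F \<subseteq> topspace K"
    and \<mu>: "\<forall>E\<in>borel_sets K. \<mu> E = discrete_measure F w E"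
  shows "upper_variation K \<mu> A = ennreal (discrete_measure F (\<lambda>x. max 0 (w x)) A)"
  unfolding upper_variation_def
proof (rule antisym)
  show "(SUP E\<in>{E \<in> borel_sets K. E \<subseteq> A}. ennreal (\<mu> E)) \<le> ennreal (discrete_measure F (\<lambda>x. max 0 (w x)) A)"
  proof (rule SUP_least)
    fix E assume E: "E \<in> {E \<in> borel_sets K. E \<subseteq> A}"
    then have "\<mu> E = discrete_measure F w E" using \<mu> by simp
    also have "\<dots> \<le> discrete_measure F (\<lambda>x. max 0 (w x)) A"
      unfolding discrete_measure_def using E by (intro sum_mono) auto
    finally show "ennreal (\<mu> E) \<le> ennreal (discrete_measure F (\<lambda>x. max 0 (w x)) A)"
      by (rule ennreal_leI)
  qed
  define E where "E = {x \<in> F \<inter> A. w x > 0}"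
  have E: "E \<in> borel_sets K"
    using F by (intro finite_borel_sets[OF K]) (auto simp: E_def)
  have "discrete_measure F (\<lambda>x. max 0 (w x)) A = \<mu> E"
    unfolding bspec[OF \<mu> E] discrete_measure_def by (intro sum.cong) (auto simp: E_def)
  then show "ennreal (discrete_measure F (\<lambda>x. max 0 (w x)) A) \<le> (SUP E\<in>{E \<in> borel_sets K. E \<subseteq> A}. ennreal (\<mu> E))"
    using E by (auto intro!: SUP_upper simp: E_def)
qed

lemma discrete_measure_nonneg:
  "(\<And>x. x \<in> F \<Longrightarrow> 0 \<le> w x) \<Longrightarrow> 0 \<le> discrete_measure F w A"
  unfolding discrete_measure_def by (intro sum_nonneg) simp

lemma discrete_measure_uminus: "discrete_measure F (\<lambda>x. - w x) A = - discrete_measure F w A"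
  by (simp add: discrete_measure_def sum_negf)

lemma variation_discrete:
  assumes K: "Hausdorff_space K" and F: "finite F" "F \<subseteq> topspace K"
    and \<mu>: "\<forall>E\<in>borel_sets K. \<mu> E = discrete_measure F w E"
  shows "lower_variation K \<mu> A = ennreal (discrete_measure F (\<lambda>x. max 0 (- w x)) A)"
    and "variation K \<mu> A = ennreal (discrete_measure F (\<lambda>x. \<bar>w x\<bar>) A)"
proof -
  show l: "lower_variation K \<mu> A = ennreal (discrete_measure F (\<lambda>x. max 0 (- w x)) A)"
    unfolding lower_variation_def
    by (rule upper_variation_discrete[OF K F]) (simp add: \<mu> discrete_measure_uminus)
  have "variation K \<mu> A = ennreal (discrete_measure F (\<lambda>x. max 0 (w x)) A + discrete_measure F (\<lambda>x. max 0 (- w x)) A)"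
    unfolding variation_def l upper_variation_discrete[OF K F \<mu>]
    by (intro ennreal_plus[symmetric] discrete_measure_nonneg) auto
  also have "discrete_measure F (\<lambda>x. max 0 (w x)) A + discrete_measure F (\<lambda>x. max 0 (- w x)) A = discrete_measure F (\<lambda>x. \<bar>w x\<bar>) A"
    unfolding discrete_measure_def sum.distrib[symmetric] by (intro sum.cong) auto
  finally show "variation K \<mu> A = ennreal (discrete_measure F (\<lambda>x. \<bar>w x\<bar>) A)" .
qed

text \<open>Inner regularity is immediate: the finite set \<open>F \<inter> A\<close> is compact and
carries the whole variation of \<open>A\<close>.\<close>

lemma signed_radon_discrete_measure:
  assumes K: "Hausdorff_space K" and F: "finite F" "F \<subseteq> topspace K"
  shows "signed_radon_measure K (discrete_measure F w)"
  unfolding signed_radon_measure_def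
proof (intro conjI ballI)
  show "signed_borel_measure K (discrete_measure F w)"
    unfolding signed_borel_measure_def
    using discrete_measure_Un_sums by (auto simp: discrete_measure_def)
  fix A assume A: "A \<in> borel_sets K"
  note var = variation_discrete(2)[OF K F, of "discrete_measure F w" w, simplified]
  show "variation K (discrete_measure F w) A =
      (SUP C\<in>{C \<in> borel_sets K. compactin K C \<and> C \<subseteq> A}. variation K (discrete_measure F w) C)"
  proof (rule antisym)
    have FA: "F \<inter> A \<subseteq> topspace K" "finite (F \<inter> A)" using F by auto
    have "F \<inter> A \<in> {C \<in> borel_sets K. compactin K C \<and> C \<subseteq> A}"
      using finite_borel_sets[OF K FA(2,1)] finite_imp_compactin[OF FA] by blast
    moreover have "variation K (discrete_measure F w) A = variation K (discrete_measure F w) (F \<inter> A)"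
      unfolding var discrete_measure_def by (intro arg_cong[where f = ennreal] sum.cong) auto
    ultimately show "variation K (discrete_measure F w) A \<le>
      (SUP C\<in>{C \<in> borel_sets K. compactin K C \<and> C \<subseteq> A}. variation K (discrete_measure F w) C)"
      by (metis (mono_tags, lifting) SUP_upper)
  next
    show "(SUP C\<in>{C \<in> borel_sets K. compactin K C \<and> C \<subseteq> A}. variation K (discrete_measure F w) C)
        \<le> variation K (discrete_measure F w) A"
      unfolding var discrete_measure_def
      by (intro SUP_least ennreal_leI sum_mono) auto
  qed
qed

lemma supp_discrete_subset:
  assumes K: "Hausdorff_space K" and F: "finite F" "F \<subseteq> topspace K"
    and \<mu>: "\<forall>E\<in>borel_sets K. \<mu> E = discrete_measure F w E"
  shows "supp K \<mu> \<subseteq> F"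
proof
  fix x assume x: "x \<in> supp K \<mu>"
  show "x \<in> F"
  proof (rule ccontr)
    assume "x \<notin> F"
    have "closedin K F"
      using finite_imp_compactin[OF F(2,1)] K compactin_imp_closedin by blast
    then have "openin K (topspace K - F)" by (simp add: closedin_def)
    moreover have "x \<in> topspace K - F" using x \<open>x \<notin> F\<close> by (simp add: supp_def)
    ultimately have "0 < variation K \<mu> (topspace K - F)" using x by (simp add: supp_def)
    then show False
      unfolding variation_discrete(2)[OF K F \<mu>] discrete_measure_def by simp
  qed
qed

lemma total_variation_discrete:
  assumes K: "Hausdorff_space K" and F: "finite F" "F \<subseteq> topspace K"
    and \<mu>: "\<forall>E\<in>borel_sets K. \<mu> E = discrete_measure F w E"
  shows "total_variation K \<mu> = ennreal (\<Sum>x\<in>F. \<bar>w x\<bar>)"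
  unfolding total_variation_def variation_discrete(2)[OF K F \<mu>] discrete_measure_def
  using F(2) by (intro arg_cong[where f = ennreal] sum.cong) auto

text \<open>The measure vanishes off \<open>F\<close>, so the integrand may be replaced by a
combination of indicators of points.\<close>

lemma integral_discrete_measure:
  assumes K: "Hausdorff_space K" and F: "finite F" "F \<subseteq> topspace K"
    and w: "\<And>x. 0 \<le> w x"
    and f: "continuous_map K euclideanreal f"
  shows "integral\<^sup>L (measure_of (topspace K) (borel_sets K) (\<lambda>A. ennreal (discrete_measure F w A))) f =
    (\<Sum>x\<in>F. w x * f x)"
proof -
  define N where "N = measure_of (topspace K) (borel_sets K) (\<lambda>A. ennreal (discrete_measure F w A))"
  have sub: "borel_sets K \<subseteq> Pow (topspace K)" using borel_sets_subset by blast
  have sets: "sets N = borel_sets K"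
    unfolding N_def using sigma_algebra.sets_measure_of_eq[OF sigma_algebra_borel_sets] .
  have space: "space N = topspace K" unfolding N_def by (rule space_measure_of[OF sub])
  have em: "emeasure N A = ennreal (discrete_measure F w A)" if "A \<in> borel_sets K" for A
  proof (rule emeasure_measure_of[OF N_def sub])
    show "A \<in> sets N" using that sets by simp
    show "positive (sets N) (\<lambda>A. ennreal (discrete_measure F w A))"
      by (simp add: positive_def discrete_measure_def)
    show "countably_additive (sets N) (\<lambda>A. ennreal (discrete_measure F w A))"
      unfolding countably_additive_def
    proof (intro allI impI)
      fix A :: "nat \<Rightarrow> 'a set" assume "disjoint_family A"
      then show "(\<Sum>i. ennreal (discrete_measure F w (A i))) = ennreal (discrete_measure F w (\<Union>i. A i))"
        by (intro suminf_ennreal_eq discrete_measure_Un_sums discrete_measure_nonneg w)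
    qed
  qed
  have pt: "{x} \<in> borel_sets K" if "x \<in> F" for x
    using that F by (intro finite_borel_sets[OF K]) auto
  have mpt: "emeasure N {x} = ennreal (w x)" if "x \<in> F" for x
    using em[OF pt[OF that]] that F(1) by (simp add: discrete_measure_def)
  have FB: "F \<in> borel_sets K" by (rule finite_borel_sets[OF K F])
  have fm: "f \<in> borel_measurable N"
  proof (rule borel_measurableI)
    fix S :: "real set" assume "open S"
    then have "openin K {x \<in> topspace K. f x \<in> S}"
      using f by (simp add: continuous_map_def)
    moreover have "{x \<in> topspace K. f x \<in> S} = f -` S \<inter> space N" using space by auto
    ultimately show "f -` S \<inter> space N \<in> sets N" using openin_borel_sets sets by metis
  qed
  define g where "g x = (\<Sum>y\<in>F. indicator {y} x *\<^sub>R f y)" for x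
  have g: "has_bochner_integral N g (\<Sum>y\<in>F. measure N {y} *\<^sub>R f y)"
    unfolding g_def
    by (intro has_bochner_integral_sum has_bochner_integral_indicator) (simp_all add: sets pt mpt)
  have "AE x in N. f x = g x"
  proof (rule AE_I)
    show "{x \<in> space N. f x \<noteq> g x} \<subseteq> topspace K - F"
      using F(1) by (auto simp: space g_def indicator_def if_distrib cong: if_cong)
    show KF: "topspace K - F \<in> sets N"
      using borel_sets_Diff[OF openin_borel_sets[OF openin_topspace] FB] sets by simp
    show "emeasure N (topspace K - F) = 0"
      using KF sets by (simp add: em discrete_measure_def)
  qed
  then have "integral\<^sup>L N f = integral\<^sup>L N g"
    using g by (intro integral_cong_AE fm) (auto dest: has_bochner_integral_integrable)
  also have "\<dots> = (\<Sum>y\<in>F. measure N {y} *\<^sub>R f y)" using g by (rule has_bochner_integral_integral_eq)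
  also have "\<dots> = (\<Sum>y\<in>F. w y * f y)"
    using mpt w by (intro sum.cong) (auto simp: measure_def)
  finally show ?thesis unfolding N_def .
qed

lemma signed_integral_discrete:
  assumes K: "Hausdorff_space K" and F: "finite F" "F \<subseteq> topspace K"
    and \<mu>: "\<forall>E\<in>borel_sets K. \<mu> E = discrete_measure F w E"
    and f: "continuous_map K euclideanreal f"
  shows "signed_integral K \<mu> f = (\<Sum>x\<in>F. w x * f x)"
proof -
  have "upper_variation K \<mu> = (\<lambda>A. ennreal (discrete_measure F (\<lambda>x. max 0 (w x)) A))"
    "lower_variation K \<mu> = (\<lambda>A. ennreal (discrete_measure F (\<lambda>x. max 0 (- w x)) A))"
    using upper_variation_discrete[OF K F \<mu>] variation_discrete(1)[OF K F \<mu>] by auto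
  then have "signed_integral K \<mu> f = (\<Sum>x\<in>F. max 0 (w x) * f x) - (\<Sum>x\<in>F. max 0 (- w x) * f x)"
    unfolding signed_integral_def by (simp add: integral_discrete_measure[OF K F _ f])
  also have "\<dots> = (\<Sum>x\<in>F. w x * f x)"
    unfolding sum_subtractf[symmetric] by (intro sum.cong) (auto simp: max_def)
  finally show ?thesis .
qed

lemma signed_borel_measure_Un:
  assumes "signed_borel_measure K \<mu>" "A \<in> borel_sets K" "B \<in> borel_sets K" "A \<inter> B = {}"
  shows "\<mu> (A \<union> B) = \<mu> A + \<mu> B"
proof -
  have "{} \<in> borel_sets K" by (rule openin_borel_sets) simp
  then have "range (binaryset A B) \<subseteq> borel_sets K" using assms(2,3) by (simp add: range_binaryset_eq)
  moreover have "disjoint_family (binaryset A B)"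
    using assms(4) by (auto simp: disjoint_family_on_def binaryset_def)
  ultimately have "(\<lambda>n. \<mu> (binaryset A B n)) sums \<mu> (\<Union>n. binaryset A B n)"
    using assms(1) unfolding signed_borel_measure_def by blast
  moreover have "(\<lambda>n. \<mu> (binaryset A B n)) sums (\<mu> A + \<mu> B)"
    by (rule binaryset_sums) (use assms(1) in \<open>simp add: signed_borel_measure_def\<close>)
  ultimately show ?thesis using sums_unique2 by (metis UN_binaryset_eq)
qed

lemma variation_eq_0_iff:
  "variation K \<mu> V = 0 \<longleftrightarrow> (\<forall>E\<in>borel_sets K. E \<subseteq> V \<longrightarrow> \<mu> E = 0)"
proof -
  have *: "upper_variation K \<nu> V = 0 \<longleftrightarrow> (\<forall>E\<in>borel_sets K. E \<subseteq> V \<longrightarrow> \<nu> E \<le> 0)" for \<nu>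
    unfolding upper_variation_def bot_ennreal[symmetric] SUP_bot_conv(1)
    by (auto simp: ennreal_eq_0_iff bot_ennreal)
  show ?thesis unfolding variation_def lower_variation_def by (auto simp: * intro: antisym)
qed

lemma variation_eq_0D:
  "variation K \<mu> V = 0 \<Longrightarrow> E \<in> borel_sets K \<Longrightarrow> E \<subseteq> V \<Longrightarrow> \<mu> E = 0"
  by (simp add: variation_eq_0_iff)

text \<open>Nullity of every Borel subset passes to finite unions by cutting a Borel set along the
members.\<close>

lemma variation_Union_eq_0:
  assumes \<mu>: "signed_borel_measure K \<mu>" and "finite \<V>"
    and "\<And>V. V \<in> \<V> \<Longrightarrow> openin K V \<and> variation K \<mu> V = 0"
  shows "variation K \<mu> (\<Union>\<V>) = 0"
  using assms(2,3)
proof (induction \<V> rule: finite_induct)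
  case empty
  then show ?case using \<mu> by (simp add: variation_eq_0_iff signed_borel_measure_def)
next
  case (insert V \<V>)
  show ?case
    unfolding variation_eq_0_iff
  proof (intro ballI impI)
    fix E assume E: "E \<in> borel_sets K" "E \<subseteq> \<Union> (insert V \<V>)"
    have V: "V \<in> borel_sets K" using insert.prems openin_borel_sets by blast
    have "E \<inter> V \<in> borel_sets K" "E - V \<in> borel_sets K"
      using borel_sets_Int[OF E(1) V] borel_sets_Diff[OF E(1) V] .
    moreover from this have "\<mu> (E \<inter> V) = 0"
      using insert.prems[of V] variation_eq_0D[of K \<mu> V "E \<inter> V"] by simp
    moreover have "variation K \<mu> (\<Union>\<V>) = 0" using insert by blast
    then have "\<mu> (E - V) = 0"
      by (rule variation_eq_0D[OF _ \<open>E - V \<in> borel_sets K\<close>]) (use E(2) in auto)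
    moreover have "(E \<inter> V) \<union> (E - V) = E" "(E \<inter> V) \<inter> (E - V) = {}" by auto
    ultimately show "\<mu> E = 0" using signed_borel_measure_Un[OF \<mu>, of "E \<inter> V" "E - V"] by simp
  qed
qed

text \<open>Each point off the support has a null open neighbourhood, so compact sets off the
support are null by a finite subcover. Inner regularity extends this to the complement of the
support.\<close>

lemma variation_off_supp:
  assumes \<mu>: "signed_radon_measure K \<mu>" and "supp K \<mu> \<in> borel_sets K"
  shows "variation K \<mu> (topspace K - supp K \<mu>) = 0"
proof -
  have "variation K \<mu> C = 0" if C: "compactin K C" "C \<subseteq> topspace K - supp K \<mu>" for C
  proof -
    define \<U> where "\<U> = {V. openin K V \<and> variation K \<mu> V = 0}"
    have "C \<subseteq> \<Union>\<U>"
    proof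
      fix x assume "x \<in> C"
      then have "x \<in> topspace K" "x \<notin> supp K \<mu>" using C(2) by auto
      then show "x \<in> \<Union>\<U>" by (auto simp: supp_def \<U>_def)
    qed
    moreover have "Ball \<U> (openin K)" by (simp add: \<U>_def)
    ultimately obtain \<V> where \<V>: "finite \<V>" "\<V> \<subseteq> \<U>" "C \<subseteq> \<Union>\<V>"
      using C(1) unfolding compactin_def by blast
    have "variation K \<mu> (\<Union>\<V>) = 0"
      using \<mu> \<V> by (intro variation_Union_eq_0) (auto simp: \<U>_def signed_radon_measure_def)
    then show ?thesis using variation_eq_0D order_trans[OF _ \<V>(3)] unfolding variation_eq_0_iff by metis
  qed
  moreover have "topspace K - supp K \<mu> \<in> borel_sets K"
    using borel_sets_Diff[OF openin_borel_sets[OF openin_topspace] assms(2)] .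
  then have "variation K \<mu> (topspace K - supp K \<mu>) =
      (SUP C\<in>{C \<in> borel_sets K. compactin K C \<and> C \<subseteq> topspace K - supp K \<mu>}. variation K \<mu> C)"
    using \<mu> unfolding signed_radon_measure_def by blast
  ultimately show ?thesis by (simp add: SUP_bot_conv(1) flip: bot_ennreal)
qed

lemma radon_finite_supp_eq_discrete:
  assumes K: "Hausdorff_space K" and \<mu>: "signed_radon_measure K \<mu>" and fin: "finite (supp K \<mu>)"
    and E: "E \<in> borel_sets K"
  shows "\<mu> E = discrete_measure (supp K \<mu>) (\<lambda>x. \<mu> {x}) E"
proof -
  define S where "S = supp K \<mu>"
  have ST: "S \<subseteq> topspace K" by (auto simp: S_def supp_def)
  have sb: "signed_borel_measure K \<mu>" using \<mu> by (simp add: signed_radon_measure_def)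
  have SB: "S \<in> borel_sets K" using finite_borel_sets[OF K _ ST] fin by (simp add: S_def)
  have finsum: "\<mu> T = (\<Sum>x\<in>T. \<mu> {x})" if "finite T" "T \<subseteq> S" for T
    using that
  proof (induction T rule: finite_induct)
    case empty
    then show ?case using sb by (simp add: signed_borel_measure_def)
  next
    case (insert x T)
    then have "{x} \<in> borel_sets K" "T \<in> borel_sets K"
      using ST by (auto intro!: finite_borel_sets[OF K])
    then show ?case using signed_borel_measure_Un[OF sb, of "{x}" T] insert by simp
  qed
  have ES: "E \<inter> S \<in> borel_sets K" "E - S \<in> borel_sets K"
    using borel_sets_Int[OF E SB] borel_sets_Diff[OF E SB] .
  have "\<mu> (E - S) = 0"
    by (rule variation_eq_0D[OF variation_off_supp[OF \<mu> SB[unfolded S_def]] ES(2)])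
       (use borel_sets_subset[OF E] in \<open>auto simp: S_def\<close>)
  moreover have "(E \<inter> S) \<union> (E - S) = E" "(E \<inter> S) \<inter> (E - S) = {}" by auto
  ultimately have "\<mu> E = \<mu> (E \<inter> S)" using signed_borel_measure_Un[OF sb ES] by simp
  also have "\<dots> = (\<Sum>x\<in>S \<inter> E. \<mu> {x})" using finsum[of "E \<inter> S"] fin by (simp add: S_def Int_commute)
  also have "\<dots> = (\<Sum>x\<in>S. \<mu> {x} * of_bool (x \<in> E))"
    using fin by (simp add: S_def sum.inter_restrict of_bool_def if_distrib cong: if_cong)
  finally show ?thesis by (simp add: discrete_measure_def S_def)
qed

section \<open>The Stone space of the density algebra\<close>

text \<open>A clopen set that separates infinitely many terms from the limit contradicts
convergence. Only the terms that differ from the limit are separated; there are infinitely many of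
them unless the sequence is eventually constant.\<close>

lemma no_nontrivial_convergent_sequence: "\<not> nontrivial_convergent_seq St_density x"
proof
  assume x: "nontrivial_convergent_seq St_density x"
  have ux: "density_ultrafilter (x n)" for n
    using x unfolding nontrivial_convergent_seq_def density.topspace_Stone by blast
  obtain l where l: "limitin St_density x l sequentially"
    using x unfolding nontrivial_convergent_seq_def by blast
  have ul: "density_ultrafilter l"
    using limitin_topspace[OF l] unfolding density.topspace_Stone by simp
  have "\<not> (\<forall>\<^sub>F n in sequentially. x n = l)"
    using x unfolding nontrivial_convergent_seq_def by blast
  then have inf: "infinite {n. x n \<noteq> l}"
    by (simp add: eventually_cofinite flip: cofinite_eq_sequentially)
  have "\<exists>S\<subseteq>{n. x n \<noteq> l}. \<exists>C\<in>density_algebra. infinite S \<and> (\<forall>n\<in>S. C \<in> x n \<and> C \<notin> l)"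
    by (rule separate_sequences[OF inf ux ul]) simp
  then obtain S C where S: "infinite S" "C \<in> density_algebra" "\<forall>n\<in>S. C \<in> x n \<and> C \<notin> l"
    by (elim exE conjE bexE)
  then obtain n where "n \<in> S" by (metis ex_in_conv finite.emptyI)
  then have "- C \<in> l" using S(2,3) density_ultrafilter_Compl_iff[OF ul] by simp
  then have "l \<in> density.Stone_set (- C)" using ul by simp
  moreover have "openin St_density (density.Stone_set (- C))"
    by (rule density.openin_Stone_set[OF density_algebra_Compl[OF S(2)]])
  ultimately have "\<forall>\<^sub>F n in sequentially. x n \<in> density.Stone_set (- C)"
    using l unfolding limitin_def by blast
  then obtain N where N: "\<And>n. n \<ge> N \<Longrightarrow> - C \<in> x n" by (auto simp: eventually_sequentially)
  obtain n where "n \<in> S" "n \<ge> N" using S(1) by (meson infinite_nat_iff_unbounded_le)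
  then show False using N S(3) density_ultrafilter_Compl_iff[OF ux S(2)] by blast
qed

lemma infinite_subset_closure_beta_omega:
  assumes "X \<subseteq> topspace St_density" "infinite X"
  shows "\<exists>Y. Y \<subseteq> X \<and> infinite Y \<and>
         subtopology St_density (St_density closure_of Y) homeomorphic_space beta_omega"
proof -
  have uf: "density_ultrafilter u" if "u \<in> X" for u
    using assms(1) that unfolding density.topspace_Stone by blast
  have "\<exists>y. inj y \<and> range y \<subseteq> X \<and> (\<forall>S. \<exists>A\<in>density_algebra. \<forall>n::nat. A \<in> y n \<longleftrightarrow> n \<in> S)"
    by (rule infinite_set_contains_independent_sequence[OF assms(2)], rule uf)
  then obtain y where y: "inj y" "range y \<subseteq> X"
      "\<forall>S. \<exists>A\<in>density_algebra. \<forall>n::nat. A \<in> y n \<longleftrightarrow> n \<in> S"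
    by (elim exE conjE)
  have "subtopology St_density (St_density closure_of range y) homeomorphic_space beta_omega"
    by (rule density.Stone_closure_homeomorphic_beta_omega) (use y(2,3) uf in auto)
  moreover have "infinite (range y)" using y(1) by (rule range_inj_infinite)
  ultimately show ?thesis using y(2) by blast
qed

text \<open>Boundedness turns convergence along a set of density one into convergence of the means,
since the exceptional indices have vanishing frequency.\<close>

lemma Cesaro_mean_tendsto:
  fixes g :: "nat \<Rightarrow> real"
  assumes bound: "\<And>k. \<bar>g k\<bar> \<le> B"
    and lim: "\<And>e. e > 0 \<Longrightarrow> \<exists>A. density_zero (- A) \<and> (\<forall>k\<in>A. \<bar>g k - L\<bar> < e)"
  shows "(\<lambda>n. (\<Sum>k<n. g k) / real n) \<longlonglongrightarrow> L"
proof (rule LIMSEQ_I)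
  fix r :: real assume "r > 0"
  then obtain A where A: "density_zero (- A)" "\<And>k. k \<in> A \<Longrightarrow> \<bar>g k - L\<bar> < r / 2"
    using lim[of "r / 2"] by auto
  define c where "c = B + \<bar>L\<bar>"
  have gc: "\<bar>g k - L\<bar> \<le> c" for k using bound[of k] by (simp add: c_def)
  have c0: "0 \<le> c" using gc[of 0] by linarith
  have "(\<lambda>n. c * freq (- A) n) \<longlonglongrightarrow> c * 0"
    using A(1) unfolding density_zero_def by (intro tendsto_intros)
  then have "\<forall>\<^sub>F n in sequentially. c * freq (- A) n < r / 2"
    using \<open>r > 0\<close> by (intro order_tendstoD(2)) auto
  then obtain N where N: "\<And>n. n \<ge> N \<Longrightarrow> c * freq (- A) n < r / 2"
    by (auto simp: eventually_sequentially)
  have "norm ((\<Sum>k<n. g k) / real n - L) < r" if n: "n \<ge> N" "n > 0" for n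
  proof -
    have "(\<Sum>k<n. g k) / real n - L = (\<Sum>k<n. g k - L) / real n"
      using n(2) by (simp add: sum_subtractf field_simps)
    also have "\<bar>\<dots>\<bar> = \<bar>\<Sum>k<n. g k - L\<bar> / real n" by simp
    also have "\<dots> \<le> (\<Sum>k<n. r / 2 + c * of_bool (k \<in> - A)) / real n"
    proof (rule divide_right_mono)
      have "\<bar>\<Sum>k<n. g k - L\<bar> \<le> (\<Sum>k<n. \<bar>g k - L\<bar>)" by (rule sum_abs)
      also have "\<dots> \<le> (\<Sum>k<n. r / 2 + c * of_bool (k \<in> - A))"
      proof (rule sum_mono)
        fix k
        show "\<bar>g k - L\<bar> \<le> r / 2 + c * of_bool (k \<in> - A)"
          using A(2)[of k] gc[of k] \<open>r > 0\<close> by (cases "k \<in> A") auto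
      qed
      finally show "\<bar>\<Sum>k<n. g k - L\<bar> \<le> (\<Sum>k<n. r / 2 + c * of_bool (k \<in> - A))" .
    qed simp
    also have "(\<Sum>k<n. r / 2 + c * of_bool (k \<in> - A)) = real n * (r / 2) + c * real (card (- A \<inter> {..<n}))"
    proof -
      have "(\<Sum>k<n. of_bool (k \<in> - A) :: real) = real (card ({..<n} \<inter> {k. k \<in> - A}))"
        by simp
      also have "{..<n} \<inter> {k. k \<in> - A} = - A \<inter> {..<n}" by blast
      finally have card: "(\<Sum>k<n. of_bool (k \<in> - A) :: real) = real (card (- A \<inter> {..<n}))" .
      show ?thesis
        unfolding sum.distrib sum_distrib_left[symmetric] card by simp
    qed
    also have "\<dots> / real n = r / 2 + c * freq (- A) n"
      using n(2) by (simp add: freq_def add_divide_distrib)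
    finally show ?thesis using N[OF n(1)] by simp
  qed
  then show "\<exists>M. \<forall>n\<ge>M. norm ((\<Sum>k<n. g k) / real n - L) < r"
    by (intro exI[of _ "N + 1"]) auto
qed

text \<open>A neighbourhood of \<open>density_one_point\<close> contains the principal ultrafilters
at almost all integers in the sense of density, so the uniform distributions on initial segments
converge weakly to the point mass at \<open>density_one_point\<close>.\<close>

lemma continuous_map_St_density_means:
  assumes f: "continuous_map St_density euclideanreal f"
  shows "(\<lambda>n. (\<Sum>k<n. f (principal k)) / real n) \<longlonglongrightarrow> f density_one_point"
proof -
  have "compactin St_density (topspace St_density)"
    using density.compact_Stone_space by (simp add: compact_space_def)
  then have "compact (f ` topspace St_density)"
    using image_compactin[OF _ f] by simp
  then have "bounded (f ` topspace St_density)" by (rule compact_imp_bounded)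
  then obtain B where B: "\<And>u. u \<in> topspace St_density \<Longrightarrow> \<bar>f u\<bar> \<le> B"
    unfolding bounded_iff by auto
  show ?thesis
  proof (rule Cesaro_mean_tendsto)
    show "\<bar>f (principal k)\<bar> \<le> B" for k
      using density_ultrafilter_principal by (intro B) (simp add: density.topspace_Stone)
    fix e :: real assume "e > 0"
    define W where "W = {u \<in> topspace St_density. f u \<in> ball (f density_one_point) e}"
    have "openin St_density W"
      unfolding W_def by (rule openin_continuous_map_preimage[OF f]) simp
    moreover have "density_one_point \<in> W"
      using density_ultrafilter_density_one_point \<open>e > 0\<close> by (simp add: W_def density.topspace_Stone)
    ultimately obtain A where A: "A \<in> density_algebra" "A \<in> density_one_point" "density.Stone_set A \<subseteq> W"
      using density.Stone_space_base by blast
    have "\<bar>f (principal k) - f density_one_point\<bar> < e" if "k \<in> A" for k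
    proof -
      have "principal k \<in> density.Stone_set A"
        using that A(1) density_ultrafilter_principal by (simp add: principal_def)
      then have "principal k \<in> W" using A(3) by blast
      then show ?thesis by (simp add: W_def dist_real_def abs_minus_commute)
    qed
    then show "\<exists>A. density_zero (- A) \<and> (\<forall>k\<in>A. \<bar>f (principal k) - f density_one_point\<bar> < e)"
      using A(2) unfolding density_one_point_def by blast
  qed
qed

lemma inj_principal: "inj principal"
proof (rule injI)
  fix j k assume "principal j = principal k"
  moreover have "{j} \<in> principal j" by (simp add: principal_def density_algebra_iff density_zero_finite)
  ultimately show "j = k" by (simp add: principal_def)
qed

lemma principal_neq_density_one_point: "principal k \<noteq> density_one_point"
proof
  assume *: "principal k = density_one_point"
  have "{k} \<in> principal k" by (simp add: principal_def density_algebra_iff density_zero_finite)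
  then have "density_zero (- {k})" using * by (simp add: density_one_point_def)
  then have "density_zero ({k} \<union> - {k})" by (intro density_zero_Un[OF density_zero_finite[of "{k}"]]) auto
  moreover have "{k} \<union> - {k} = UNIV" by blast
  ultimately show False using not_density_zero_UNIV by metis
qed

text \<open>The measures are half the difference between the uniform distribution on the first
\<open>n + 1\<close> principal ultrafilters and the point mass at \<open>density_one_point\<close>.
The two parts have disjoint supports, which gives norm one.\<close>

lemma fsJNP_St_density: "fsJNP St_density"
proof -
  define F where "F n = insert density_one_point (principal ` {..<Suc n})" for n
  define w where "w n u = (if u = density_one_point then - 1 / 2 else 1 / (2 * real (Suc n)))" for n u
  have sumF: "(\<Sum>u\<in>F n. h u) = h density_one_point + (\<Sum>k<Suc n. h (principal k))" for n and h :: "_ \<Rightarrow> real"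
  proof -
    have "density_one_point \<notin> principal ` {..<Suc n}"
      using principal_neq_density_one_point by (metis imageE)
    then have "(\<Sum>u\<in>F n. h u) = h density_one_point + (\<Sum>u\<in>principal ` {..<Suc n}. h u)"
      unfolding F_def by (intro sum.insert) auto
    also have "(\<Sum>u\<in>principal ` {..<Suc n}. h u) = (\<Sum>k<Suc n. h (principal k))"
      by (subst sum.reindex) (auto intro: inj_on_subset[OF inj_principal])
    finally show ?thesis .
  qed
  have H: "Hausdorff_space St_density" by (rule density.Hausdorff_Stone_space)
  have F: "finite (F n)" "F n \<subseteq> topspace St_density" for n
    using density_ultrafilter_density_one_point density_ultrafilter_principal
    by (auto simp: F_def density.topspace_Stone)
  have "fsJN_sequence St_density (\<lambda>n. discrete_measure (F n) (w n))"
    unfolding fsJN_sequence_def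
  proof (intro conjI allI impI)
    fix n
    show "signed_radon_measure St_density (discrete_measure (F n) (w n))"
      by (rule signed_radon_discrete_measure[OF H F])
    show "finite (supp St_density (discrete_measure (F n) (w n)))"
      by (rule finite_subset[OF supp_discrete_subset[OF H F[of n], where w = "w n"] F(1)]) simp
    have "(\<Sum>u\<in>F n. \<bar>w n u\<bar>) = 1"
      unfolding sumF by (simp add: w_def principal_neq_density_one_point divide_simps)
    then show "total_variation St_density (discrete_measure (F n) (w n)) = 1"
      by (subst total_variation_discrete[OF H F[of n], where w = "w n"]) simp_all
  next
    fix f assume f: "continuous_map St_density euclideanreal f"
    have "signed_integral St_density (discrete_measure (F n) (w n)) f =
        (1 / 2) * ((\<Sum>k<Suc n. f (principal k)) / real (Suc n)) - f density_one_point / 2" for n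
    proof -
      have "signed_integral St_density (discrete_measure (F n) (w n)) f = (\<Sum>u\<in>F n. w n u * f u)"
        by (rule signed_integral_discrete[OF H F _ f]) simp
      also have "\<dots> = (\<Sum>k<Suc n. 1 / (2 * real (Suc n)) * f (principal k)) - f density_one_point / 2"
        unfolding sumF by (simp add: w_def principal_neq_density_one_point)
      also have "(\<Sum>k<Suc n. 1 / (2 * real (Suc n)) * f (principal k)) =
          (1 / 2) * ((\<Sum>k<Suc n. f (principal k)) / real (Suc n))"
        unfolding sum_distrib_left[symmetric] by (simp del: sum.lessThan_Suc)
      finally show ?thesis .
    qed
    moreover have "(\<lambda>n. (1 / 2) * ((\<Sum>k<Suc n. f (principal k)) / real (Suc n)) - f density_one_point / 2)
        \<longlonglongrightarrow> (1 / 2) * f density_one_point - f density_one_point / 2"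
      by (intro tendsto_intros LIMSEQ_Suc[OF continuous_map_St_density_means[OF f]]) simp
    ultimately show "(\<lambda>n. signed_integral St_density (discrete_measure (F n) (w n)) f) \<longlonglongrightarrow> 0"
      by simp
  qed
  then show ?thesis
    unfolding fsJNP_def using H density.compact_Stone_space by blast
qed

text \<open>If infinitely many supports have at most \<open>m\<close> points, each of these measures
has an atom of weight at least \<open>1/m\<close>. For infinitely many of them, one clopen set
contains the atom and no other point of the support. The integral of its indicator is then the
weight of the atom, which does not tend to zero.\<close>

lemma fsJN_sequence_supports_unbounded:
  assumes \<mu>: "fsJN_sequence St_density \<mu>"
  shows "filterlim (\<lambda>n. card (supp St_density (\<mu> n))) at_top sequentially"
proof (rule ccontr)
  assume "\<not> ?thesis"
  then obtain m where m: "\<not> (\<forall>\<^sub>F n in sequentially. m \<le> card (supp St_density (\<mu> n)))"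
    unfolding filterlim_at_top by blast
  define R where "R = {n. card (supp St_density (\<mu> n)) \<le> m}"
  have "infinite {n. \<not> m \<le> card (supp St_density (\<mu> n))}"
    using m by (simp add: eventually_cofinite flip: cofinite_eq_sequentially)
  then have R: "infinite R"
    by (rule infinite_super[rotated]) (auto simp: R_def)
  define S where "S n = supp St_density (\<mu> n)" for n
  define w where "w n u = \<mu> n {u}" for n u
  have H: "Hausdorff_space St_density" by (rule density.Hausdorff_Stone_space)
  have rad: "signed_radon_measure St_density (\<mu> n)" "finite (S n)" "total_variation St_density (\<mu> n) = 1" for n
    using \<mu> unfolding fsJN_sequence_def S_def by blast+
  have ST: "S n \<subseteq> topspace St_density" for n by (auto simp: S_def supp_def)
  have discrete: "\<forall>E\<in>borel_sets St_density. \<mu> n E = discrete_measure (S n) (w n) E" for n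
    unfolding S_def w_def
    using radon_finite_supp_eq_discrete[OF H rad(1)] rad(2) unfolding S_def by blast
  have tot: "(\<Sum>u\<in>S n. \<bar>w n u\<bar>) = 1" for n
    using total_variation_discrete[OF H rad(2) ST discrete, of n] rad(3)[of n]
    by (metis ennreal_eq_1)
  have "\<exists>u\<in>S n. 1 \<le> real m * \<bar>w n u\<bar>" if "n \<in> R" for n
  proof (rule ccontr)
    assume small: "\<not> ?thesis"
    have ne: "S n \<noteq> {}" using tot[of n] by auto
    have "0 < card (S n)" using ne rad(2) by (simp add: card_gt_0_iff)
    then have "real m > 0" using that by (simp add: R_def S_def)
    have "real m = (\<Sum>u\<in>S n. real m * \<bar>w n u\<bar>)" using tot[of n] by (simp flip: sum_distrib_left)
    also have "\<dots> < (\<Sum>u\<in>S n. 1)"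
      using small ne rad(2) by (intro sum_strict_mono) (auto simp: not_le)
    also have "\<dots> \<le> real m" using that by (simp add: R_def S_def)
    finally show False by simp
  qed
  then obtain x where x: "\<And>n. n \<in> R \<Longrightarrow> x n \<in> S n" "\<And>n. n \<in> R \<Longrightarrow> 1 \<le> real m * \<bar>w n (x n)\<bar>"
    by metis
  have uf: "density_ultrafilter u" if "u \<in> S n" for u n
    using ST that unfolding density.topspace_Stone by blast
  have "\<exists>T\<subseteq>R. \<exists>C\<in>density_algebra. infinite T \<and> (\<forall>n\<in>T. C \<in> x n \<and> (\<forall>u\<in>S n - {x n}. C \<notin> u))"
  proof (rule separate_from_bounded_sets[OF R])
    fix n assume n: "n \<in> R"
    show "density_ultrafilter (x n)" using uf x(1)[OF n] by blast
    have "card (S n - {x n}) \<le> card (S n)" using rad(2) by (intro card_mono) auto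
    also have "\<dots> \<le> m" using n by (simp add: R_def S_def)
    finally show "finite (S n - {x n}) \<and> card (S n - {x n}) \<le> m" using rad(2) by simp
  next
    fix n u assume "u \<in> S n - {x n}"
    then show "density_ultrafilter u \<and> u \<noteq> x n" using uf by blast
  qed
  then obtain T C where T: "T \<subseteq> R" "C \<in> density_algebra" "infinite T"
      "\<And>n. n \<in> T \<Longrightarrow> C \<in> x n" "\<And>n u. n \<in> T \<Longrightarrow> u \<in> S n \<Longrightarrow> u \<noteq> x n \<Longrightarrow> C \<notin> u"
    by (elim exE conjE bexE) auto
  define f where "f = (\<lambda>u. of_bool (C \<in> u) :: real)"
  have f: "continuous_map St_density euclideanreal f"
    unfolding f_def by (rule density.continuous_map_Stone_indicator[OF T(2)])
  have int: "signed_integral St_density (\<mu> n) f = w n (x n)" if "n \<in> T" for n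
  proof -
    have "n \<in> R" using that T(1) by blast
    have "signed_integral St_density (\<mu> n) f = (\<Sum>u\<in>S n. w n u * f u)"
      by (rule signed_integral_discrete[OF H rad(2) ST discrete f])
    also have "\<dots> = (\<Sum>u\<in>S n. if u = x n then w n u else 0)"
      using T(4,5)[OF that] by (intro sum.cong) (auto simp: f_def)
    also have "\<dots> = w n (x n)" using x(1)[OF \<open>n \<in> R\<close>] rad(2) by simp
    finally show ?thesis .
  qed
  have "(\<lambda>n. real m * \<bar>signed_integral St_density (\<mu> n) f\<bar>) \<longlonglongrightarrow> real m * \<bar>0\<bar>"
    using \<mu> f unfolding fsJN_sequence_def by (intro tendsto_intros) blast
  then have "\<forall>\<^sub>F n in sequentially. real m * \<bar>signed_integral St_density (\<mu> n) f\<bar> < 1"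
    by (intro order_tendstoD(2)) auto
  then obtain N where N: "\<And>n. n \<ge> N \<Longrightarrow> real m * \<bar>signed_integral St_density (\<mu> n) f\<bar> < 1"
    by (auto simp: eventually_sequentially)
  obtain n where n: "n \<in> T" "n \<ge> N" using T(3) by (meson infinite_nat_iff_unbounded_le)
  then have "n \<in> R" using T(1) by blast
  then show False using N[OF n(2)] int[OF n(1)] x(2) by fastforce
qed

theorem proposition5p2:
  "\<not> (\<exists>x. nontrivial_convergent_seq St_density x) \<and>
   (\<forall>X. X \<subseteq> topspace St_density \<longrightarrow> infinite X \<longrightarrow>
      (\<exists>Y. Y \<subseteq> X \<and> infinite Y \<and>
         subtopology St_density (St_density closure_of Y) homeomorphic_space beta_omega)) \<and>
   fsJNP St_density \<and>
   (\<forall>\<mu>. fsJN_sequence St_density \<mu> \<longrightarrow>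
      filterlim (\<lambda>n. card (supp St_density (\<mu> n))) at_top sequentially)"
  using no_nontrivial_convergent_sequence infinite_subset_closure_beta_omega fsJNP_St_density
    fsJN_sequence_supports_unbounded
  by (intro conjI allI impI notI) (elim exE, blast, assumption+)

end
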